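(* Let $l\ge0$. In local coordinates, the induced map $\bar I_l\colon\mathrm{Gr}^l\Omega^{n,2}_0\to\mathrm{Gr}^l\Omega^{n,2}_0$ acts by $$A^I_{\alpha\beta}\,\theta^\alpha\wedge\theta^\beta_I\wedge\nu\longmapsto\frac12\big(A^I_{\alpha\beta}+(-1)^{l+1}A^I_{\beta\alpha}\big)\,\theta^\alpha\wedge\theta^\beta_I\wedge\nu,$$ where $A^I_{\alpha\beta}\in\mathcal R^\infty$ and repeated indices $\alpha,\beta$ and the multi-index $I$ with $|I|=l$ are summed over. Consequently, $$\mathrm{im}(\bar I_l)=\big\{A^I_{\alpha\beta}\,\theta^\alpha\wedge\theta^\beta_I\wedge\nu: A^I_{\alpha\beta}=(-1)^{l+1}A^I_{\beta\alpha}\big\},\qquad \ker(\bar I_l)=\big\{A^I_{\alpha\beta}\,\theta^\alpha\wedge\theta^\beta_I\wedge\nu: A^I_{\alpha\beta}=(-1)^{l}A^I_{\beta\alpha}\big\},$$ the conditions being required for all $\alpha,\beta$ and all $I$ with $|I|=l$.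
   Context: Let $\pi\colon E\to M$ be a smooth fibre bundle with finite-dimensional fibres over an $n$-dimensional manifold $M$ with a chosen volume form $\nu$. Let $x^i$ ($1\le i\le n$) be local coordinates on $M$ and $u^\alpha$ local fibre coordinates on $E$; the claim is about expressions over such a coordinate chart. The $k$-jet space $J^kE$ has fibre coordinates $u^\alpha_I$, $0\le|I|\le k$, over $M$, where $I$ is an unordered (symmetric) multi-index with entries in $\{1,\dots,n\}$ and $|I|$ is its length; $Ij$ denotes $I$ with $j$ appended. $J^\infty E$ is the inverse limit of the $J^kE$. Smooth functions and forms on $J^\infty E$ are those of finite order: $\mathcal R^\infty=\bigcup_{k\ge0}C^\infty(J^kE)$ and $\Omega^p(J^\infty E)=\bigcup_{k\ge0}\Omega^p(J^kE)$ (identified via pull-back). Contact forms are $\theta^\alpha_I=du^\alpha_I-u^\alpha_{Ij}dx^j$ (summation convention), and $\theta^\alpha:=\theta^\alpha_\emptyset$. $\Omega^{n,2}_0$ is the $\mathcal R^\infty$-module of finite $\mathcal R^\infty$-linear combinations of the $(n+2)$-forms $\theta^\alpha\wedge\theta^\beta_I\wedge\nu$. For $l\ge0$, $\mathrm{F}^l\Omega^{n,2}_0$ is the $\mathcal R^\infty$-span of those with $|I|\le l$; $\mathrm{F}^{-1}\Omega^{n,2}_0=0$; and $\mathrm{Gr}^l\Omega^{n,2}_0=\mathrm{F}^l\Omega^{n,2}_0/\mathrm{F}^{l-1}\Omega^{n,2}_0$, which is the $\mathcal R^\infty$-span of (the classes of) $\theta^\alpha\wedge\theta^\beta_I\wedge\nu$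 with $|I|=l$; classes are denoted by their representatives. The total derivative is $D_j=\frac{\partial}{\partial x^j}+\sum_{|I|\ge0}u^\alpha_{Ij}\frac{\partial}{\partial u^\alpha_I}$; it acts on forms by Lie derivative, so $D_j\theta^\alpha_I=\theta^\alpha_{Ij}$ and $D_jdx^i=0$. For $I=(i_1,\dots,i_k)$, $(-D)_I=(-1)^kD_{i_1}\cdots D_{i_k}$. Put $\partial^I_\alpha=\partial/\partial u^\alpha_I$. The interior Euler operator on forms of horizontal degree $n$ and vertical degree $2$ is the $\mathbb R$-linear map $$I(\omega)=\frac12\,\theta^\alpha\wedge\sum_{|I|\ge0}(-D)_I\big(\partial^I_\alpha\lrcorner\,\omega\big),$$ the sum being over all unordered multi-indices (the letter $I$ is used both for the operator and for multi-indices). It maps $\mathrm{F}^l\Omega^{n,2}_0$ into itself for all $l$, and $\bar I_l$ denotes the induced map $\omega+\mathrm{F}^{l-1}\Omega^{n,2}_0\mapsto I(\omega)+\mathrm{F}^{l-1}\Omega^{n,2}_0$ on $\mathrm{Gr}^l\Omega^{n,2}_0$. *)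

theory Defs
  imports "HOL-Analysis.Analysis" "HOL-Library.Multiset" "HOL-Library.Groups_Big_Fun"
begin

section \<open>Infinite jets over an adapted chart\<close>

text \<open>
  The finite types \<open>'n\<close> and \<open>'m\<close> index the base coordinates and the fibre coordinates.
  \<open>'n\<close> is linearly ordered because the coordinate volume form is an ordered product.
  Unordered multi-indices are multisets, and \<open>add_mset j I\<close> is \<open>Ij\<close>.
  An adapted chart of the bundle has an open set \<open>W\<close> of pairs (base point, fibre point) as
  its image; its base part is \<open>fst ` W\<close>. Jets and tangent vectors of the infinite jet
  space are both given by their components.
\<close>

datatype ('n, 'm) coord = Base 'n | Fib 'm "'n multiset"

type_synonym ('n, 'm) jet = "('n, 'm) coord \<Rightarrow> real"
type_synonym ('n, 'm) tangent = "('n, 'm) coord \<Rightarrow> real"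

definition base_pt :: "('n::finite, 'm) jet \<Rightarrow> real ^ 'n" where
  "base_pt z = (\<chi> i. z (Base i))"

definition fibre_pt :: "('n, 'm::finite) jet \<Rightarrow> real ^ 'm" where
  "fibre_pt z = (\<chi> a. z (Fib a {#}))"

definition jet_space :: "((real ^ 'n::finite) \<times> (real ^ 'm::finite)) set \<Rightarrow> ('n, 'm) jet set" where
  "jet_space W = {z. (base_pt z, fibre_pt z) \<in> W}"

fun coord_order :: "('n, 'm) coord \<Rightarrow> nat" where
  "coord_order (Base i) = 0"
| "coord_order (Fib a I) = size I"

definition coord_deriv :: "('n, 'm) coord \<Rightarrow> (('n, 'm) jet \<Rightarrow> real) \<Rightarrow> ('n, 'm) jet \<Rightarrow> real" where
  "coord_deriv c f z = deriv (\<lambda>t. f (z(c := t))) (z c)"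

text \<open>
  All iterated partial derivatives exist and are continuous. Continuity refers to the
  product topology; for a function of finite order this is continuity on the
  corresponding finite jet space.
\<close>

definition smooth_on_jets ::
    "((real ^ 'n::finite) \<times> (real ^ 'm::finite)) set \<Rightarrow> (('n, 'm) jet \<Rightarrow> real) \<Rightarrow> bool" where
  "smooth_on_jets W f \<longleftrightarrow>
     (\<forall>cs. continuous_on (jet_space W) (foldr coord_deriv cs f) \<and>
        (\<forall>c. \<forall>z\<in>jet_space W.
           (\<lambda>t. foldr coord_deriv cs f (z(c := t))) differentiable (at (z c))))"

text \<open>
  Functions on the jet space are represented by total functions vanishing outside of it,
  so that equality of functions, and of forms below, is equality on the jet space.
\<close>

definition smooth_funs_order ::
    "((real ^ 'n::finite) \<times> (real ^ 'm::finite)) set \<Rightarrow> nat \<Rightarrow> (('n, 'm) jet \<Rightarrow> real) set" where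
  "smooth_funs_order W k =
     {f. smooth_on_jets W f \<and>
         (\<forall>z\<in>jet_space W. \<forall>z'\<in>jet_space W.
            (\<forall>c. coord_order c \<le> k \<longrightarrow> z c = z' c) \<longrightarrow> f z = f z') \<and>
         (\<forall>z. z \<notin> jet_space W \<longrightarrow> f z = 0)}"

definition smooth_funs ::
    "((real ^ 'n::finite) \<times> (real ^ 'm::finite)) set \<Rightarrow> (('n, 'm) jet \<Rightarrow> real) set" where
  "smooth_funs W = (\<Union>k. smooth_funs_order W k)"


section \<open>Differential forms\<close>

text \<open>
  A form assigns to a jet a function of the list of its vector arguments;
  a p-form vanishes on lists of length other than p.
\<close>

type_synonym ('n, 'm) one_form = "('n, 'm) jet \<Rightarrow> ('n, 'm) tangent \<Rightarrow> real"
type_synonym ('n, 'm) form = "('n, 'm) jet \<Rightarrow> ('n, 'm) tangent list \<Rightarrow> real"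

definition unit_form :: "('n, 'm) form" where
  "unit_form z vs = (if vs = [] then 1 else 0)"

text \<open>
  The exterior product of a 1-form with a form (determinant convention, so that iterated
  products of 1-forms evaluate to determinants). All exterior products below are of this kind.
\<close>

definition wedge :: "('n, 'm) one_form \<Rightarrow> ('n, 'm) form \<Rightarrow> ('n, 'm) form"  (infixr "\<and>\<^sub>1" 70) where
  "(\<phi> \<and>\<^sub>1 \<omega>) z vs =
     (\<Sum>i<length vs. (- 1) ^ i * \<phi> z (vs ! i) * \<omega> z (take i vs @ drop (Suc i) vs))"

definition contract :: "('n, 'm) tangent \<Rightarrow> ('n, 'm) form \<Rightarrow> ('n, 'm) form" where
  "contract v \<omega> z vs = \<omega> z (v # vs)"

definition coord_vec :: "('n, 'm) coord \<Rightarrow> ('n, 'm) tangent" where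
  "coord_vec c = (\<lambda>d. if d = c then 1 else 0)"

definition dx :: "'n \<Rightarrow> ('n, 'm) one_form" where
  "dx i z v = v (Base i)"

definition theta :: "'m \<Rightarrow> 'n::finite multiset \<Rightarrow> ('n, 'm) one_form" where
  "theta a I z v = v (Fib a I) - (\<Sum>j\<in>UNIV. z (Fib a (add_mset j I)) * dx j z v)"

text \<open>
  A volume form on the base is \<open>\<rho> dx\<^sup>1 \<and> \<dots> \<and> dx\<^sup>n\<close> with a smooth nowhere vanishing density \<open>\<rho>\<close>.
\<close>

definition volume_density ::
    "((real ^ 'n::finite) \<times> (real ^ 'm::finite)) set \<Rightarrow> (real ^ 'n \<Rightarrow> real) \<Rightarrow> bool" where
  "volume_density W \<rho> \<longleftrightarrow>
     smooth_on_jets W (\<lambda>z. \<rho> (base_pt z)) \<and> (\<forall>x \<in> fst ` W. \<rho> x \<noteq> 0)"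

definition vol :: "(real ^ 'n::{finite,linorder} \<Rightarrow> real) \<Rightarrow> ('n, 'm) form" where
  "vol \<rho> z vs = \<rho> (base_pt z) * foldr (\<and>\<^sub>1) (map dx (sorted_list_of_set UNIV)) unit_form z vs"


section \<open>Total derivatives\<close>

text \<open>
  The derivative of a function along a vector. For a function of finite order only finitely
  many summands are nonzero.
\<close>

definition vec_deriv :: "('n, 'm) tangent \<Rightarrow> (('n, 'm) jet \<Rightarrow> real) \<Rightarrow> ('n, 'm) jet \<Rightarrow> real" where
  "vec_deriv v f z = Sum_any (\<lambda>c. v c * coord_deriv c f z)"

text \<open>
  For vector fields \<open>X\<close> and \<open>v\<^sub>1, \<dots>, v\<^sub>p\<close>, the Lie derivative evaluated at the \<open>v\<^sub>i\<close> is
  \<open>X (\<omega> (v\<^sub>1, \<dots>, v\<^sub>p)) - (\<Sum>i. \<omega> (v\<^sub>1, \<dots>, [X, v\<^sub>i], \<dots>, v\<^sub>p))\<close>. A vector is extended to the vector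
  field \<open>v\<close> with constant components; then \<open>[X, v]\<close> has components \<open>- v (X\<^sup>c)\<close>.
\<close>

definition lie_deriv ::
    "(('n, 'm) jet \<Rightarrow> ('n, 'm) tangent) \<Rightarrow> ('n, 'm) form \<Rightarrow> ('n, 'm) form" where
  "lie_deriv X \<omega> z vs =
     vec_deriv (X z) (\<lambda>y. \<omega> y vs) z +
     (\<Sum>i<length vs. \<omega> z (vs[i := (\<lambda>c. vec_deriv (vs ! i) (\<lambda>y. X y c) z)]))"

fun total_field :: "'n \<Rightarrow> ('n, 'm) jet \<Rightarrow> ('n, 'm) tangent" where
  "total_field j z (Base i) = (if i = j then 1 else 0)"
| "total_field j z (Fib a I) = z (Fib a (add_mset j I))"

definition total_deriv :: "'n \<Rightarrow> ('n, 'm) form \<Rightarrow> ('n, 'm) form" where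
  "total_deriv j = lie_deriv (total_field j)"

text \<open>
  The total derivatives commute on forms of finite order, so the order of composition
  is immaterial; the entries of the multi-index are taken in increasing order.
\<close>

definition neg_total_deriv :: "'n::linorder multiset \<Rightarrow> ('n, 'm) form \<Rightarrow> ('n, 'm) form" where
  "neg_total_deriv J \<omega> z vs =
     (- 1) ^ size J * foldr total_deriv (sorted_list_of_multiset J) \<omega> z vs"

text \<open>On forms of finite order, only finitely many of the multi-indices contribute to the sum.\<close>

definition interior_euler ::
    "((real ^ 'n::{finite,linorder}) \<times> (real ^ 'm::finite)) set \<Rightarrow> ('n, 'm) form \<Rightarrow> ('n, 'm) form" where
  "interior_euler W \<omega> z vs =
     (if z \<in> jet_space W then
        1 / 2 * (\<Sum>a\<in>UNIV. (theta a {#} \<and>\<^sub>1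
          (\<lambda>y ws. Sum_any (\<lambda>J. neg_total_deriv J (contract (coord_vec (Fib a J)) \<omega>) y ws))) z vs)
      else 0)"


section \<open>The filtration and its graded pieces\<close>

definition contact_comb ::
    "(real ^ 'n::{finite,linorder} \<Rightarrow> real) \<Rightarrow> 'n multiset set \<Rightarrow>
      ('m \<Rightarrow> 'm \<Rightarrow> 'n multiset \<Rightarrow> ('n, 'm) jet \<Rightarrow> real) \<Rightarrow> ('n, 'm::finite) form" where
  "contact_comb \<rho> S A z vs =
     (\<Sum>a\<in>UNIV. \<Sum>b\<in>UNIV. \<Sum>I\<in>S. A a b I z * (theta a {#} \<and>\<^sub>1 theta b I \<and>\<^sub>1 vol \<rho>) z vs)"

text \<open>Defined for integers, so that the piece of index \<open>- 1\<close> is zero (the empty sum).\<close>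

definition filt ::
    "((real ^ 'n::{finite,linorder}) \<times> (real ^ 'm::finite)) set \<Rightarrow> (real ^ 'n::{finite,linorder} \<Rightarrow> real) \<Rightarrow> int \<Rightarrow>
      ('n, 'm) form set" where
  "filt W \<rho> l =
     {contact_comb \<rho> {I. int (size I) \<le> l} A | A. \<forall>a b I. A a b I \<in> smooth_funs W}"

definition gr_rel ::
    "((real ^ 'n::{finite,linorder}) \<times> (real ^ 'm::finite)) set \<Rightarrow> (real ^ 'n::{finite,linorder} \<Rightarrow> real) \<Rightarrow> nat \<Rightarrow>
      (('n, 'm) form \<times> ('n, 'm) form) set" where
  "gr_rel W \<rho> l =
     {(\<omega>, \<eta>). \<omega> \<in> filt W \<rho> (int l) \<and> \<eta> \<in> filt W \<rho> (int l) \<and>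
        (\<lambda>z vs. \<omega> z vs - \<eta> z vs) \<in> filt W \<rho> (int l - 1)}"

definition gr ::
    "((real ^ 'n::{finite,linorder}) \<times> (real ^ 'm::finite)) set \<Rightarrow> (real ^ 'n::{finite,linorder} \<Rightarrow> real) \<Rightarrow> nat \<Rightarrow>
      ('n, 'm) form set set" where
  "gr W \<rho> l = filt W \<rho> (int l) // gr_rel W \<rho> l"

definition gr_class ::
    "((real ^ 'n::{finite,linorder}) \<times> (real ^ 'm::finite)) set \<Rightarrow> (real ^ 'n::{finite,linorder} \<Rightarrow> real) \<Rightarrow> nat \<Rightarrow>
      ('n, 'm) form \<Rightarrow> ('n, 'm) form set" where
  "gr_class W \<rho> l \<omega> = gr_rel W \<rho> l `` {\<omega>}"

text \<open>The union is over equal classes, as the interior Euler operator respects the filtration.\<close>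

definition gr_euler ::
    "((real ^ 'n::{finite,linorder}) \<times> (real ^ 'm::finite)) set \<Rightarrow> (real ^ 'n::{finite,linorder} \<Rightarrow> real) \<Rightarrow> nat \<Rightarrow>
      ('n, 'm) form set \<Rightarrow> ('n, 'm) form set" where
  "gr_euler W \<rho> l C = (\<Union>\<omega>\<in>C. gr_class W \<rho> l (interior_euler W \<omega>))"

text \<open>
  The class of \<open>A\<^sup>I\<^sub>\<alpha>\<^sub>\<beta> \<theta>\<^sup>\<alpha> \<and> \<theta>\<^sup>\<beta>\<^sub>I \<and> \<nu>\<close>, summed over all \<open>\<alpha>\<close>, \<open>\<beta>\<close> and \<open>I\<close> of length \<open>l\<close>.
  Coefficients at other multi-indices are irrelevant.
\<close>

definition gr_elem ::
    "((real ^ 'n::{finite,linorder}) \<times> (real ^ 'm::finite)) set \<Rightarrow> (real ^ 'n::{finite,linorder} \<Rightarrow> real) \<Rightarrow> nat \<Rightarrow>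
      ('m \<Rightarrow> 'm \<Rightarrow> 'n multiset \<Rightarrow> ('n, 'm) jet \<Rightarrow> real) \<Rightarrow> ('n, 'm) form set" where
  "gr_elem W \<rho> l A = gr_class W \<rho> l (contact_comb \<rho> {I. size I = l} A)"

definition smooth_coeffs ::
    "((real ^ 'n::finite) \<times> (real ^ 'm::finite)) set \<Rightarrow> nat \<Rightarrow>
      ('m \<Rightarrow> 'm \<Rightarrow> 'n multiset \<Rightarrow> ('n, 'm) jet \<Rightarrow> real) set" where
  "smooth_coeffs W l = {A. \<forall>a b I. size I = l \<longrightarrow> A a b I \<in> smooth_funs W}"

end

theory Submission imports Defs
begin

text \<open>
  Why the formula holds. The contraction of \<open>\<theta>\<^sup>a \<and> \<theta>\<^sup>b\<^sub>I \<and> \<nu>\<close> with \<open>\<partial>/\<partial>u\<^sup>c\<^sub>J\<close> has two parts. The part coming from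
  \<open>\<theta>\<^sup>a\<close> occurs only for \<open>J = \<emptyset>\<close>, needs no derivatives, and reproduces the form itself after
  \<open>\<theta>\<^sup>c\<close> is multiplied back in. The part coming from \<open>\<theta>\<^sup>b\<^sub>I\<close> occurs only for \<open>J = I\<close>, \<open>c = b\<close>
  and is \<open>- A \<theta>\<^sup>a \<and> \<nu>\<close>. Total derivatives act on \<open>f \<theta>\<^sup>a\<^sub>K \<and> \<nu>\<close> by the Leibniz rule, and only the term
  in which the derivative falls on \<open>\<theta>\<^sup>a\<^sub>K\<close> raises the order of the contact form. So \<open>(-D)\<^sub>I\<close> turns
  \<open>- A \<theta>\<^sup>a \<and> \<nu>\<close> into \<open>(-1)\<^bsup>|I|+1\<^esup> A \<theta>\<^sup>a\<^sub>I \<and> \<nu>\<close> modulo contact forms of order below \<open>|I|\<close>; after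
  multiplication by \<open>\<theta>\<^sup>b\<close> this is the transposed coefficient with the sign of the formula.

  The lemma \<open>interior_euler_contact_comb\<close> states this without congruences: a representative with
  smooth coefficients \<open>A\<close> is sent to one with smooth coefficients \<open>B\<close>, and the coefficients of
  \<open>B\<close> of order \<open>l\<close> are given by the coefficients of \<open>A\<close> of order \<open>l\<close>. That the induced map is well
  defined follows at once: changing a form by an element of the lower filtration step changes
  only the lower coefficients of \<open>A\<close>. For \<open>l = 0\<close> the coefficients are not determined by the form,
  since \<open>\<theta>\<^sup>a \<and> \<theta>\<^sup>b\<close> is antisymmetric; the argument never needs them to be.

  On coefficients the induced map is half of the identity plus a signed flip, that is, a projection
  onto one of the two eigenspaces of the flip, and image and kernel are the two eigenspaces.
\<close>


section \<open>Smooth functions of finite order\<close>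

text \<open>
  The functions in question are only defined on the jet space, so every partial derivative taken
  at one of its points must be insensitive to values outside of it. As \<open>W\<close> is open, this holds: a single
  coordinate may be moved a little without leaving the jet space.
\<close>

lemma eventually_update_in_jet_space:
  assumes "open W" "z \<in> jet_space W"
  shows "\<forall>\<^sub>F t in nhds (z c). z(c := t) \<in> jet_space W"
proof -
  let ?h = "\<lambda>t. (base_pt (z(c := t)), fibre_pt (z(c := t)))"
  have "continuous_on UNIV (\<lambda>t. if d = c then t else z d)" for d :: "('a, 'b) coord"
    by (cases "d = c") auto
  then have "continuous_on UNIV ?h"
    unfolding base_pt_def fibre_pt_def fun_upd_def
    by (intro continuous_on_Pair continuous_on_vec_lambda)
  then have "open (?h -` W)"
    using assms(1) by (rule open_vimage[rotated])
  moreover have "z c \<in> ?h -` W"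
    using assms(2) by (simp add: jet_space_def)
  ultimately show ?thesis
    using eventually_nhds_in_open by (fastforce simp: jet_space_def elim: eventually_mono)
qed

lemma coord_deriv_cong:
  assumes "open W" "z \<in> jet_space W" "\<And>y. y \<in> jet_space W \<Longrightarrow> f y = g y"
  shows "coord_deriv c f z = coord_deriv c g z"
  unfolding coord_deriv_def
  using eventually_update_in_jet_space[OF assms(1,2), of c]
  by (intro deriv_cong_ev) (auto elim: eventually_mono simp: assms(3))

definition partially_C1 ::
    "((real ^ 'n::finite) \<times> (real ^ 'm::finite)) set \<Rightarrow> (('n, 'm) jet \<Rightarrow> real) \<Rightarrow> bool" where
  "partially_C1 W f \<longleftrightarrow> continuous_on (jet_space W) f \<and>
     (\<forall>c. \<forall>z\<in>jet_space W. (\<lambda>t. f (z(c := t))) differentiable (at (z c)))"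

text \<open>
  Smoothness quantifies over lists of coordinates, applied from the right. Cutting it into
  finitely many orders, with the innermost derivative split off, gives a predicate on which
  the Leibniz and quotient rules can be proved by induction on the order.
\<close>

fun times_differentiable ::
    "((real ^ 'n::finite) \<times> (real ^ 'm::finite)) set \<Rightarrow> nat \<Rightarrow> (('n, 'm) jet \<Rightarrow> real) \<Rightarrow> bool" where
  "times_differentiable W 0 f \<longleftrightarrow> True"
| "times_differentiable W (Suc k) f \<longleftrightarrow>
     partially_C1 W f \<and> (\<forall>c. times_differentiable W k (coord_deriv c f))"

lemma times_differentiable_foldr:
  "times_differentiable W k f \<longleftrightarrow> (\<forall>cs. length cs < k \<longrightarrow> partially_C1 W (foldr coord_deriv cs f))"
proof (induction k arbitrary: f)
  case (Suc k)
  have "(\<forall>cs. length cs < Suc k \<longrightarrow> partially_C1 W (foldr coord_deriv cs f)) \<longleftrightarrow>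
    partially_C1 W f \<and>
    (\<forall>c cs. length cs < k \<longrightarrow> partially_C1 W (foldr coord_deriv cs (coord_deriv c f)))" (is "?l \<longleftrightarrow> ?r")
  proof
    assume l: ?l
    have "partially_C1 W (foldr coord_deriv cs (coord_deriv c f))" if "length cs < k" for c cs
      using l[rule_format, of "cs @ [c]"] that by simp
    then show ?r using l[rule_format, of "[]"] by simp
  next
    assume r: ?r
    show ?l
    proof (intro allI impI)
      fix cs :: "('a, 'b) coord list"
      assume "length cs < Suc k"
      then show "partially_C1 W (foldr coord_deriv cs f)"
        using r by (cases cs rule: rev_cases) auto
    qed
  qed
  then show ?case using Suc by auto
qed simp

lemma smooth_on_jets_iff: "smooth_on_jets W f \<longleftrightarrow> (\<forall>k. times_differentiable W k f)"
  unfolding smooth_on_jets_def times_differentiable_foldr partially_C1_def by blast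

lemma times_differentiable_cong:
  assumes "open W" "\<And>z. z \<in> jet_space W \<Longrightarrow> f z = g z" "times_differentiable W k g"
  shows "times_differentiable W k f"
  using assms(2,3)
proof (induction k arbitrary: f g)
  case (Suc k)
  have "(\<lambda>t. f (z(c := t))) differentiable at (z c)" if z: "z \<in> jet_space W" for z c
  proof -
    have "\<forall>\<^sub>F t in nhds (z c). g (z(c := t)) = f (z(c := t))"
      using eventually_update_in_jet_space[OF assms(1) z, of c]
      by eventually_elim (rule Suc.prems(1)[symmetric])
    moreover have "(\<lambda>t. g (z(c := t))) differentiable at (z c)"
      using Suc.prems(2) z by (simp add: partially_C1_def)
    ultimately show ?thesis
      by (metis DERIV_cong_ev real_differentiable_def)
  qed
  moreover have "continuous_on (jet_space W) f"
    using Suc.prems by (auto simp: partially_C1_def cong: continuous_on_cong)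
  moreover have "times_differentiable W k (coord_deriv c f)" for c
  proof (rule Suc.IH)
    show "coord_deriv c f z = coord_deriv c g z" if "z \<in> jet_space W" for z
      using assms(1) that Suc.prems(1) by (rule coord_deriv_cong)
    show "times_differentiable W k (coord_deriv c g)"
      using Suc.prems(2) by simp
  qed
  ultimately show ?case by (simp add: partially_C1_def)
qed simp

lemma times_differentiable_SucD: "times_differentiable W (Suc k) f \<Longrightarrow> times_differentiable W k f"
  by (simp add: times_differentiable_foldr)

lemma partially_C1_DERIV:
  assumes "partially_C1 W f" "z \<in> jet_space W"
  shows "((\<lambda>t. f (z(c := t))) has_field_derivative coord_deriv c f z) (at (z c))"
  using assms unfolding partially_C1_def coord_deriv_def
  by (simp add: DERIV_deriv_iff_real_differentiable)

lemma coord_deriv_eqI: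
  "((\<lambda>t. f (z(c := t))) has_field_derivative D) (at (z c)) \<Longrightarrow> coord_deriv c f z = D"
  unfolding coord_deriv_def by (rule DERIV_imp_deriv)

lemma times_differentiable_const: "times_differentiable W k (\<lambda>z. a)"
proof (induction k arbitrary: a)
  case (Suc k)
  have "coord_deriv c (\<lambda>z. a) = (\<lambda>z. 0)" for c :: "('a, 'b) coord"
    by (auto simp: coord_deriv_def)
  then show ?case using Suc by (simp add: partially_C1_def)
qed simp

lemma times_differentiable_coord: "times_differentiable W k (\<lambda>z. z c)"
proof (cases k)
  case (Suc k)
  have D: "((\<lambda>t. (z(d := t)) c) has_field_derivative (if d = c then 1 else 0)) (at (z d))"
    for z :: "('a, 'b) jet" and d by (auto intro!: derivative_eq_intros)
  then have "coord_deriv d (\<lambda>z. z c) = (\<lambda>z. if d = c then 1 else 0)" for d :: "('a, 'b) coord"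
    by (intro ext coord_deriv_eqI D)
  moreover have "continuous_on (jet_space W) (\<lambda>z. z c)"
    by (rule continuous_on_subset[OF continuous_on_product_coordinates]) simp
  ultimately show ?thesis using D Suc times_differentiable_const
    by (auto simp: partially_C1_def real_differentiable_def)
qed simp

lemma times_differentiable_add:
  assumes "open W"
  shows "times_differentiable W k f \<Longrightarrow> times_differentiable W k g \<Longrightarrow>
    times_differentiable W k (\<lambda>z. f z + g z)"
proof (induction k arbitrary: f g)
  case (Suc k)
  have D: "((\<lambda>t. f (z(c := t)) + g (z(c := t))) has_field_derivative
      coord_deriv c f z + coord_deriv c g z) (at (z c))" if "z \<in> jet_space W" for z c
    using Suc.prems that by (auto intro!: derivative_eq_intros partially_C1_DERIV)
  have "times_differentiable W k (coord_deriv c (\<lambda>z. f z + g z))" for c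
    by (rule times_differentiable_cong[OF assms(1) coord_deriv_eqI[OF D]])
       (use Suc in auto)
  then show ?case using Suc.prems D
    by (auto simp: partially_C1_def real_differentiable_def intro!: continuous_intros)
qed simp

lemma times_differentiable_mult:
  assumes "open W"
  shows "times_differentiable W k f \<Longrightarrow> times_differentiable W k g \<Longrightarrow>
    times_differentiable W k (\<lambda>z. f z * g z)"
proof (induction k arbitrary: f g)
  case (Suc k)
  have D: "((\<lambda>t. f (z(c := t)) * g (z(c := t))) has_field_derivative
      coord_deriv c f z * g z + f z * coord_deriv c g z) (at (z c))" if "z \<in> jet_space W" for z c
    using Suc.prems that DERIV_mult[OF partially_C1_DERIV[of W f z c] partially_C1_DERIV[of W g z c]]
    by (simp add: mult.commute)
  have "times_differentiable W k (coord_deriv c (\<lambda>z. f z * g z))" for c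
    by (rule times_differentiable_cong[OF assms(1) coord_deriv_eqI[OF D]])
       (use Suc.prems times_differentiable_SucD[OF Suc.prems(1)] times_differentiable_SucD[OF Suc.prems(2)]
        in \<open>auto intro!: times_differentiable_add[OF assms(1)] Suc.IH\<close>)
  then show ?case using Suc.prems D
    by (auto simp: partially_C1_def real_differentiable_def intro!: continuous_intros)
qed simp

text \<open>
  The derivative of \<open>1/g\<close> is a product of \<open>1/g\<close>, \<open>1/g\<close> and a derivative of \<open>g\<close>, so differentiability
  of order \<open>k\<close> of \<open>1/g\<close> itself gives the next order. It will be applied to the density
  of the volume form.
\<close>

lemma times_differentiable_inverse:
  assumes "open W" "\<And>k. times_differentiable W k g" "\<And>z. z \<in> jet_space W \<Longrightarrow> g z \<noteq> 0"
  shows "times_differentiable W k (\<lambda>z. inverse (g z))"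
proof (induction k)
  case (Suc k)
  have g: "partially_C1 W g" "\<And>c. times_differentiable W k (coord_deriv c g)"
    using assms(2)[of "Suc k"] by auto
  have D: "((\<lambda>t. inverse (g (z(c := t)))) has_field_derivative
      - 1 * (inverse (g z) * coord_deriv c g z * inverse (g z))) (at (z c))"
    if "z \<in> jet_space W" for z c
    using DERIV_inverse'[OF partially_C1_DERIV[OF g(1) that, of c]] assms(3)[OF that] by simp
  have "times_differentiable W k (coord_deriv c (\<lambda>z. inverse (g z)))" for c
    by (rule times_differentiable_cong[OF assms(1) coord_deriv_eqI[OF D]], assumption)
       (intro times_differentiable_mult times_differentiable_const assms(1) Suc.IH g)
  then show ?case using g(1) D assms(3)
    by (auto simp: partially_C1_def real_differentiable_def simp del: mult_minus1
        intro!: continuous_intros)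
qed simp

definition jet_order_le ::
    "((real ^ 'n::finite) \<times> (real ^ 'm::finite)) set \<Rightarrow> nat \<Rightarrow> (('n, 'm) jet \<Rightarrow> real) \<Rightarrow> bool" where
  "jet_order_le W k f \<longleftrightarrow> (\<forall>z\<in>jet_space W. \<forall>z'\<in>jet_space W.
            (\<forall>c. coord_order c \<le> k \<longrightarrow> z c = z' c) \<longrightarrow> f z = f z')"

lemma jet_order_leD:
  "jet_order_le W k f \<Longrightarrow> z \<in> jet_space W \<Longrightarrow> z' \<in> jet_space W \<Longrightarrow>
    (\<And>c. coord_order c \<le> k \<Longrightarrow> z c = z' c) \<Longrightarrow> f z = f z'"
  unfolding jet_order_le_def by blast

lemma jet_order_le_max:
  assumes "jet_order_le W k f" "jet_order_le W k' g"
  shows "jet_order_le W (max k k') (\<lambda>z. F (f z) (g z))"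
  unfolding jet_order_le_def
proof (intro ballI impI)
  fix z z' assume z: "z \<in> jet_space W" "z' \<in> jet_space W"
    and eq: "\<forall>c. coord_order c \<le> max k k' \<longrightarrow> z c = z' c"
  have "f z = f z'" "g z = g z'"
    using eq by (auto intro!: jet_order_leD[OF assms(1) z] jet_order_leD[OF assms(2) z])
  then show "F (f z) (g z) = F (f z') (g z')" by simp
qed

lemma smooth_funs_iff:
  "f \<in> smooth_funs W \<longleftrightarrow>
     (\<forall>k. times_differentiable W k f) \<and> (\<exists>k. jet_order_le W k f) \<and> (\<forall>z. z \<notin> jet_space W \<longrightarrow> f z = 0)"
  unfolding smooth_funs_def smooth_funs_order_def smooth_on_jets_iff jet_order_le_def by blast

lemma smooth_funs_outside: "f \<in> smooth_funs W \<Longrightarrow> z \<notin> jet_space W \<Longrightarrow> f z = 0"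
  by (simp add: smooth_funs_iff)

lemma smooth_funs_zero: "(\<lambda>z. 0) \<in> smooth_funs W"
  by (auto simp: smooth_funs_iff times_differentiable_const jet_order_le_def)

lemma smooth_funs_add:
  assumes "open W" "f \<in> smooth_funs W" "g \<in> smooth_funs W"
  shows "(\<lambda>z. f z + g z) \<in> smooth_funs W"
proof -
  from assms(2,3) obtain k k' where k: "jet_order_le W k f" "jet_order_le W k' g"
    by (auto simp: smooth_funs_iff)
  have "jet_order_le W (max k k') (\<lambda>z. f z + g z)"
    using k by (rule jet_order_le_max)
  then show ?thesis
    using assms times_differentiable_add[OF assms(1)] by (fastforce simp: smooth_funs_iff)
qed

text \<open>
  One factor may be a function that does not vanish off the jet space, such as a coordinate
  or the density of the volume form.
\<close>

lemma smooth_funs_mult: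
  assumes "open W" "f \<in> smooth_funs W" "\<And>k. times_differentiable W k h" "jet_order_le W r h"
  shows "(\<lambda>z. h z * f z) \<in> smooth_funs W"
proof -
  from assms(2) obtain k where k: "jet_order_le W k f"
    by (auto simp: smooth_funs_iff)
  have "jet_order_le W (max r k) (\<lambda>z. h z * f z)"
    using assms(4) k by (rule jet_order_le_max)
  then show ?thesis
    using assms times_differentiable_mult[OF assms(1)] by (fastforce simp: smooth_funs_iff)
qed

lemma smooth_funs_scale:
  "open W \<Longrightarrow> f \<in> smooth_funs W \<Longrightarrow> (\<lambda>z. a * f z) \<in> smooth_funs W"
  by (rule smooth_funs_mult[of _ _ _ 0]) (auto simp: times_differentiable_const jet_order_le_def)

lemma smooth_funs_sum:
  assumes "open W" "\<And>i. i \<in> S \<Longrightarrow> f i \<in> smooth_funs W"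
  shows "(\<lambda>z. \<Sum>i\<in>S. f i z) \<in> smooth_funs W"
  using assms(2)
  by (induction S rule: infinite_finite_induct) (auto simp: smooth_funs_zero intro!: smooth_funs_add assms(1))

lemma coord_deriv_jet_order_le:
  assumes W: "open W" and f: "jet_order_le W k f" and z: "z \<in> jet_space W"
    and c: "k < coord_order c"
  shows "coord_deriv c f z = 0"
proof -
  have "\<forall>\<^sub>F t in nhds (z c). f (z(c := t)) = f z"
    using eventually_update_in_jet_space[OF W z]
    by eventually_elim (use c in \<open>auto intro!: jet_order_leD[OF f _ z]\<close>)
  then show ?thesis
    unfolding coord_deriv_def by (subst deriv_cong_ev[where g = "\<lambda>t. f z"]) auto
qed

text \<open>
  Two points with the same coordinates up to order \<open>k\<close> may differ in \<open>c\<close> if its order exceeds \<open>k\<close>, but then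
  both derivatives vanish.
\<close>

lemma jet_order_le_coord_deriv:
  assumes W: "open W" and f: "jet_order_le W k f"
  shows "jet_order_le W k (coord_deriv c f)"
  unfolding jet_order_le_def
proof (intro ballI impI)
  fix z z' assume z: "z \<in> jet_space W" "z' \<in> jet_space W"
    and eq: "\<forall>c. coord_order c \<le> k \<longrightarrow> z c = z' c"
  show "coord_deriv c f z = coord_deriv c f z'"
  proof (cases "coord_order c \<le> k")
    case True
    then have c: "z c = z' c" using eq by blast
    have "\<forall>\<^sub>F t in nhds (z c). f (z(c := t)) = f (z'(c := t))"
      using eventually_update_in_jet_space[OF W z(1), of c]
        eventually_update_in_jet_space[OF W z(2), of c, folded c]
      by eventually_elim (use eq in \<open>auto intro!: jet_order_leD[OF f]\<close>)
    then show ?thesis unfolding coord_deriv_def by (rule deriv_cong_ev) (rule c)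
  qed (simp add: coord_deriv_jet_order_le[OF W f] z)
qed

lemma finite_multisets_size_le: "finite {I :: 'n::finite multiset. size I \<le> k}"
proof -
  have "{I :: 'n multiset. size I \<le> k} \<subseteq> mset ` {xs. set xs \<subseteq> UNIV \<and> length xs \<le> k}"
  proof
    fix I :: "'n multiset" assume I: "I \<in> {I. size I \<le> k}"
    obtain xs where "mset xs = I" using ex_mset by blast
    with I show "I \<in> mset ` {xs. set xs \<subseteq> UNIV \<and> length xs \<le> k}" by auto
  qed
  then show ?thesis by (rule finite_subset) (intro finite_imageI finite_lists_length_le finite)
qed

lemma finite_coords_order_le: "finite {c :: ('n::finite, 'm::finite) coord. coord_order c \<le> k}"
proof -
  have "{c :: ('n, 'm) coord. coord_order c \<le> k} \<subseteq>
      range Base \<union> (\<lambda>(a, I). Fib a I) ` (UNIV \<times> {I. size I \<le> k})"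
  proof
    fix c :: "('n, 'm) coord" assume "c \<in> {c. coord_order c \<le> k}"
    then show "c \<in> range Base \<union> (\<lambda>(a, I). Fib a I) ` (UNIV \<times> {I. size I \<le> k})"
      by (cases c) auto
  qed
  then show ?thesis by (rule finite_subset) (simp add: finite_multisets_size_le)
qed

section \<open>Derivatives along tangent vectors\<close>

text \<open>
  A tangent vector has infinitely many components, and a derivative along it makes sense only
  for functions with finitely many nonzero partial derivatives. Including this finiteness in the
  predicate lets the usual rules of differentiation be composed without tracking orders.
\<close>

definition has_vec_deriv ::
    "('n, 'm) tangent \<Rightarrow> (('n, 'm) jet \<Rightarrow> real) \<Rightarrow> ('n, 'm) jet \<Rightarrow> real \<Rightarrow> bool" where
  "has_vec_deriv v f z D \<longleftrightarrow>
     (\<exists>d. (\<forall>c. ((\<lambda>t. f (z(c := t))) has_field_derivative d c) (at (z c))) \<and>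
          finite {c. d c \<noteq> 0} \<and> D = Sum_any (\<lambda>c. v c * d c))"

lemma has_vec_derivI:
  assumes "\<And>c. ((\<lambda>t. f (z(c := t))) has_field_derivative d c) (at (z c))"
    "finite {c. d c \<noteq> 0}" "D = Sum_any (\<lambda>c. v c * d c)"
  shows "has_vec_deriv v f z D"
  using assms unfolding has_vec_deriv_def by blast

lemma has_vec_derivE:
  assumes "has_vec_deriv v f z D"
  obtains d where "\<And>c. ((\<lambda>t. f (z(c := t))) has_field_derivative d c) (at (z c))"
    "finite {c. d c \<noteq> 0}" "D = Sum_any (\<lambda>c. v c * d c)"
  using assms unfolding has_vec_deriv_def by blast

lemma has_vec_deriv_imp_vec_deriv:
  assumes "has_vec_deriv v f z D"
  shows "vec_deriv v f z = D"
  using assms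
proof (rule has_vec_derivE)
  fix d
  assume d: "\<And>c. ((\<lambda>t. f (z(c := t))) has_field_derivative d c) (at (z c))"
    and D: "D = Sum_any (\<lambda>c. v c * d c)"
  show ?thesis using coord_deriv_eqI[OF d] by (simp add: vec_deriv_def D)
qed

lemma finite_weighted_support: "finite {c. d c \<noteq> 0} \<Longrightarrow> finite {c. v c * d c \<noteq> (0::real)}"
  by (erule finite_subset[rotated]) auto

lemma has_vec_deriv_const: "has_vec_deriv v (\<lambda>y. a) z 0"
  by (rule has_vec_derivI[of _ _ "\<lambda>c. 0"]) auto

lemma has_vec_deriv_coord: "has_vec_deriv v (\<lambda>y. y c) z (v c)"
proof (rule has_vec_derivI[of _ _ "\<lambda>d. if d = c then 1 else 0"])
  show "v c = Sum_any (\<lambda>d. v d * (if d = c then 1 else 0))"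
    by (subst Sum_any.expand_superset[of "{c}"]) auto
qed (auto intro!: derivative_eq_intros)

lemma has_vec_deriv_add:
  assumes "has_vec_deriv v f z D" "has_vec_deriv v g z E"
  shows "has_vec_deriv v (\<lambda>y. f y + g y) z (D + E)"
proof -
  from assms obtain d e where
    d: "\<And>c. ((\<lambda>t. f (z(c := t))) has_field_derivative d c) (at (z c))"
      "finite {c. d c \<noteq> 0}" "D = Sum_any (\<lambda>c. v c * d c)" and
    e: "\<And>c. ((\<lambda>t. g (z(c := t))) has_field_derivative e c) (at (z c))"
      "finite {c. e c \<noteq> 0}" "E = Sum_any (\<lambda>c. v c * e c)"
    by (elim has_vec_derivE) blast
  show ?thesis
  proof (rule has_vec_derivI)
    show "((\<lambda>t. f (z(c := t)) + g (z(c := t))) has_field_derivative d c + e c) (at (z c))" for c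
      by (intro DERIV_add d e)
    show "finite {c. d c + e c \<noteq> 0}"
      by (rule finite_subset[OF _ finite_UnI[OF d(2) e(2)]]) auto
    show "D + E = Sum_any (\<lambda>c. v c * (d c + e c))"
      using Sum_any.distrib[OF d(2)[THEN finite_weighted_support] e(2)[THEN finite_weighted_support]]
      by (simp add: d(3) e(3) distrib_left)
  qed
qed

lemma has_vec_deriv_mult:
  assumes "has_vec_deriv v f z D" "has_vec_deriv v g z E"
  shows "has_vec_deriv v (\<lambda>y. f y * g y) z (D * g z + f z * E)"
proof -
  from assms obtain d e where
    d: "\<And>c. ((\<lambda>t. f (z(c := t))) has_field_derivative d c) (at (z c))"
      "finite {c. d c \<noteq> 0}" "D = Sum_any (\<lambda>c. v c * d c)" and
    e: "\<And>c. ((\<lambda>t. g (z(c := t))) has_field_derivative e c) (at (z c))"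
      "finite {c. e c \<noteq> 0}" "E = Sum_any (\<lambda>c. v c * e c)"
    by (elim has_vec_derivE) blast
  show ?thesis
  proof (rule has_vec_derivI)
    show "((\<lambda>t. f (z(c := t)) * g (z(c := t))) has_field_derivative d c * g z + f z * e c) (at (z c))" for c
      using DERIV_mult[OF d(1) e(1), of c] by (simp add: mult.commute)
    show "finite {c. d c * g z + f z * e c \<noteq> 0}"
      by (rule finite_subset[OF _ finite_UnI[OF d(2) e(2)]]) auto
    have fin: "finite {c. v c * d c * g z \<noteq> 0}" "finite {c. f z * (v c * e c) \<noteq> 0}"
      by (rule finite_subset[OF _ d(2)], force) (rule finite_subset[OF _ e(2)], force)
    show "D * g z + f z * E = Sum_any (\<lambda>c. v c * (d c * g z + f z * e c))"
      using Sum_any.distrib[OF fin]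
      unfolding d(3) e(3) Sum_any_left_distrib[OF d(2)[THEN finite_weighted_support]]
        Sum_any_right_distrib[OF e(2)[THEN finite_weighted_support]]
      by (simp add: algebra_simps)
  qed
qed

lemma has_vec_deriv_cmult:
  "has_vec_deriv v f z D \<Longrightarrow> has_vec_deriv v (\<lambda>y. a * f y) z (a * D)"
  using has_vec_deriv_mult[OF has_vec_deriv_const] by fastforce

lemma has_vec_deriv_sum:
  "(\<And>i. i \<in> S \<Longrightarrow> has_vec_deriv v (f i) z (D i)) \<Longrightarrow>
    has_vec_deriv v (\<lambda>y. \<Sum>i\<in>S. f i y) z (\<Sum>i\<in>S. D i)"
  by (induction S rule: infinite_finite_induct) (auto simp: has_vec_deriv_const intro: has_vec_deriv_add)

lemma smooth_funs_has_vec_deriv: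
  assumes W: "open W" and f: "f \<in> smooth_funs W" and z: "z \<in> jet_space W"
  shows "has_vec_deriv v f z (vec_deriv v f z)"
proof -
  from f obtain k where k: "jet_order_le W k f" by (auto simp: smooth_funs_iff)
  have C1: "partially_C1 W f"
    using f times_differentiable.simps(2)[of W 0 f] by (simp add: smooth_funs_iff del: times_differentiable.simps)
  have "finite {c. coord_deriv c f z \<noteq> 0}"
    by (rule finite_subset[OF _ finite_coords_order_le[of k]])
       (use coord_deriv_jet_order_le[OF W k z] in force)
  then show ?thesis
    by (intro has_vec_derivI[of _ _ "\<lambda>c. coord_deriv c f z"] partially_C1_DERIV[OF C1 z])
       (auto simp: vec_deriv_def)
qed

text \<open>
  The total derivative of a function, cut off outside of the jet space so that it is again in
  the ring of smooth functions.
\<close>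

definition fun_total_deriv ::
    "((real ^ 'n::finite) \<times> (real ^ 'm::finite)) set \<Rightarrow> 'n \<Rightarrow> (('n, 'm) jet \<Rightarrow> real) \<Rightarrow> ('n, 'm) jet \<Rightarrow> real" where
  "fun_total_deriv W j f z = (if z \<in> jet_space W then vec_deriv (total_field j z) f z else 0)"

lemma fun_total_deriv_zero: "fun_total_deriv W j (\<lambda>z. 0) = (\<lambda>z. 0)"
  by (auto simp: fun_total_deriv_def vec_deriv_def coord_deriv_def)

text \<open>
  On functions of order \<open>k\<close> the total derivative is a finite sum, and its coefficients are
  coordinates of order at most \<open>k + 1\<close>.
\<close>

lemma smooth_funs_fun_total_deriv:
  assumes W: "open W" and f: "f \<in> smooth_funs W"
  shows "fun_total_deriv W j f \<in> smooth_funs W"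
proof -
  from f obtain k where k: "jet_order_le W k f" by (auto simp: smooth_funs_iff)
  let ?K = "{c :: ('a, 'b) coord. coord_order c \<le> k}"
  let ?g = "\<lambda>c z. total_field j z c * (if z \<in> jet_space W then coord_deriv c f z else 0)"
  have eq: "fun_total_deriv W j f = (\<lambda>z. \<Sum>c\<in>?K. ?g c z)"
  proof
    fix z
    have "Sum_any (\<lambda>c. total_field j z c * coord_deriv c f z) =
        (\<Sum>c\<in>?K. total_field j z c * coord_deriv c f z)" if "z \<in> jet_space W"
    proof (rule Sum_any.expand_superset[OF finite_coords_order_le])
      show "{c. total_field j z c * coord_deriv c f z \<noteq> 0} \<subseteq> ?K"
        using coord_deriv_jet_order_le[OF W k that] by (auto intro: leI)
    qed
    then show "fun_total_deriv W j f z = (\<Sum>c\<in>?K. ?g c z)"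
      by (simp add: fun_total_deriv_def vec_deriv_def)
  qed
  have "?g c \<in> smooth_funs W" if c: "c \<in> ?K" for c
  proof (rule smooth_funs_mult[OF W, where r = "Suc k"])
    have "times_differentiable W r (coord_deriv c f)" for r
      using f times_differentiable.simps(2)[of W r f]
      by (simp add: smooth_funs_iff del: times_differentiable.simps)
    then have 1: "times_differentiable W r (\<lambda>z. if z \<in> jet_space W then coord_deriv c f z else 0)" for r
      by (rule times_differentiable_cong[OF W, rotated]) simp
    have 2: "jet_order_le W k (\<lambda>z. if z \<in> jet_space W then coord_deriv c f z else 0)"
      unfolding jet_order_le_def by (auto intro!: jet_order_leD[OF jet_order_le_coord_deriv[OF W k]])
    show "(\<lambda>z. if z \<in> jet_space W then coord_deriv c f z else 0) \<in> smooth_funs W"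
      unfolding smooth_funs_iff by (intro conjI allI impI exI[of _ k] 1 2) simp
  next
    show "times_differentiable W r (\<lambda>z. total_field j z c)" for r
      by (cases c) (auto simp: times_differentiable_const times_differentiable_coord)
    show "jet_order_le W (Suc k) (\<lambda>z. total_field j z c)"
      using c by (cases c) (auto simp: jet_order_le_def)
  qed
  then show ?thesis unfolding eq by (intro smooth_funs_sum W)
qed

section \<open>Contractions and total derivatives of contact forms\<close>

text \<open>
  The coordinate volume form. Everything is first proved for it; a general volume form differs
  from it by a unit of the ring of functions.
\<close>

abbreviation dx_all :: "('n::{finite,linorder}, 'm) form" where
  "dx_all \<equiv> vol (\<lambda>_. 1)"

text \<open>
  A product of the \<open>dx\<^sup>k\<close> sees only the base components of its arguments.
\<close>

lemma foldr_dx_zero_base: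
  assumes "v \<in> set vs" "\<And>k. v (Base k) = 0"
  shows "foldr (\<and>\<^sub>1) (map dx ks) unit_form z vs = 0"
  using assms(1)
proof (induction ks arbitrary: vs)
  case (Cons k ks)
  have "dx k z (vs ! i) * foldr (\<and>\<^sub>1) (map dx ks) unit_form z (take i vs @ drop (Suc i) vs) = 0"
    if i: "i < length vs" for i
  proof (cases "vs ! i = v")
    case True
    then show ?thesis using assms(2) by (simp add: dx_def)
  next
    case False
    have "v \<in> set (take i vs @ vs ! i # drop (Suc i) vs)"
      using Cons.prems id_take_nth_drop[OF i] by simp
    then have "v \<in> set (take i vs @ drop (Suc i) vs)" using False by auto
    then show ?thesis using Cons.IH by simp
  qed
  then show ?case
    by (auto simp: wedge_def[of "dx k"] intro!: sum.neutral)
qed (auto simp: unit_form_def)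

lemma dx_all_zero_base:
  "v \<in> set vs \<Longrightarrow> (\<And>k. v (Base k) = 0) \<Longrightarrow> dx_all z vs = 0"
  unfolding vol_def by (simp add: foldr_dx_zero_base)

lemma dx_all_const: "dx_all z vs = dx_all z' vs"
proof -
  have "foldr (\<and>\<^sub>1) (map dx ks) unit_form z vs = foldr (\<and>\<^sub>1) (map dx ks) unit_form z' vs" for ks :: "'a list"
    by (induction ks arbitrary: vs) (auto simp: wedge_def dx_def unit_form_def)
  then show ?thesis unfolding vol_def by simp
qed

lemma vol_eq_dx_all: "vol \<rho> z vs = \<rho> (base_pt z) * dx_all z vs"
  by (simp add: vol_def)

lemma wedge_sum: "(\<phi> \<and>\<^sub>1 (\<lambda>z vs. \<Sum>i\<in>S. \<omega> i z vs)) z vs = (\<Sum>i\<in>S. (\<phi> \<and>\<^sub>1 \<omega> i) z vs)"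
  by (simp add: wedge_def sum_distrib_left sum.swap[of _ S])

lemma wedge_scale: "(\<phi> \<and>\<^sub>1 (\<lambda>z vs. f z * \<omega> z vs)) z vs = f z * (\<phi> \<and>\<^sub>1 \<omega>) z vs"
  by (simp add: wedge_def sum_distrib_left mult.left_commute)

lemma wedge_cong: "(\<And>ws. \<omega> z ws = \<eta> z ws) \<Longrightarrow> (\<phi> \<and>\<^sub>1 \<omega>) z vs = (\<phi> \<and>\<^sub>1 \<eta>) z vs"
  by (simp add: wedge_def)

text \<open>
  The first argument of the product is either fed to \<open>\<phi>\<close> or, past \<open>\<phi>\<close>, to \<open>\<omega>\<close>.
\<close>

lemma contract_wedge:
  "contract v (\<phi> \<and>\<^sub>1 \<omega>) z vs = \<phi> z v * \<omega> z vs - (\<phi> \<and>\<^sub>1 contract v \<omega>) z vs"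
  by (simp add: contract_def wedge_def sum.lessThan_Suc_shift sum_negf del: sum.lessThan_Suc)

lemma contract_fibre_dx_all: "contract (coord_vec (Fib a J)) dx_all z vs = 0"
  unfolding contract_def by (rule dx_all_zero_base[of "coord_vec (Fib a J)"]) (auto simp: coord_vec_def)

lemma theta_fibre_vec: "theta b K z (coord_vec (Fib a J)) = (if b = a \<and> K = J then 1 else 0)"
  by (simp add: theta_def dx_def coord_vec_def)

lemma contract_theta_dx_all:
  "contract (coord_vec (Fib a J)) (theta b K \<and>\<^sub>1 dx_all) z vs =
     (if b = a \<and> K = J then dx_all z vs else 0)"
  by (simp add: contract_wedge theta_fibre_vec wedge_def contract_fibre_dx_all)

lemma contract_contact_form:
  "contract (coord_vec (Fib a J)) (theta a' {#} \<and>\<^sub>1 theta b K \<and>\<^sub>1 dx_all) z vs =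
     (if a' = a \<and> J = {#} then (theta b K \<and>\<^sub>1 dx_all) z vs else 0) -
     (if b = a \<and> K = J then (theta a' {#} \<and>\<^sub>1 dx_all) z vs else 0)"
proof -
  have "(theta a' {#} \<and>\<^sub>1 contract (coord_vec (Fib a J)) (theta b K \<and>\<^sub>1 dx_all)) z vs =
      (if b = a \<and> K = J then (theta a' {#} \<and>\<^sub>1 dx_all) z vs else 0)"
    by (cases "b = a \<and> K = J") (auto simp: wedge_def contract_theta_dx_all intro!: sum.neutral)
  then show ?thesis by (auto simp: contract_wedge theta_fibre_vec)
qed


text \<open>
  The \<open>dx\<close>-part of \<open>\<theta>\<^sup>b\<^sub>K\<close> is all that depends on the jet, and its derivative is the \<open>dx\<close>-part of
  \<open>\<theta>\<^sup>b\<^sub>K\<^sub>j\<close>. The missing \<open>du\<close>-part is supplied by the bracket terms of the Lie derivative.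
\<close>

lemma has_vec_deriv_theta:
  "has_vec_deriv (total_field j z) (\<lambda>y. theta b K y v) z
     (theta b (add_mset j K) z v - v (Fib b (add_mset j K)))"
proof -
  have "has_vec_deriv (total_field j z)
      (\<lambda>y. v (Fib b K) + (- 1) * (\<Sum>k\<in>UNIV. v (Base k) * y (Fib b (add_mset k K)))) z
      (0 + (- 1) * (\<Sum>k\<in>UNIV. v (Base k) * total_field j z (Fib b (add_mset k K))))"
    by (intro has_vec_deriv_add has_vec_deriv_const has_vec_deriv_cmult has_vec_deriv_sum
        has_vec_deriv_coord)
  then show ?thesis
    by (simp add: theta_def dx_def mult.commute add_mset_commute)
qed

lemma bracket_total_field:
  "(\<lambda>c. vec_deriv v (\<lambda>y. total_field j y c) z) =
     (\<lambda>c. case c of Base i \<Rightarrow> 0 | Fib a I \<Rightarrow> v (Fib a (add_mset j I)))"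
proof
  fix c
  show "vec_deriv v (\<lambda>y. total_field j y c) z =
      (case c of Base i \<Rightarrow> 0 | Fib a I \<Rightarrow> v (Fib a (add_mset j I)))"
    by (cases c) (auto intro!: has_vec_deriv_imp_vec_deriv has_vec_deriv_const has_vec_deriv_coord)
qed

text \<open>
  The Leibniz rule \<open>D\<^sub>j (f \<theta>\<^sup>b\<^sub>K \<and> dx) = (D\<^sub>j f) \<theta>\<^sup>b\<^sub>K \<and> dx + f \<theta>\<^sup>b\<^sub>K\<^sub>j \<and> dx\<close>, with the bracket terms of the Lie
  derivative moved to the right-hand side. In this shape it is a statement about derivatives of
  functions, so it can be summed over \<open>b\<close> and \<open>K\<close> by the rules above.
\<close>

lemma total_deriv_theta_dx_all:
  assumes f: "has_vec_deriv (total_field j z) f z D"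
  shows "has_vec_deriv (total_field j z) (\<lambda>y. f y * (theta b K \<and>\<^sub>1 dx_all) y vs) z
      (D * (theta b K \<and>\<^sub>1 dx_all) z vs + f z * ((theta b (add_mset j K) \<and>\<^sub>1 dx_all) z vs -
       (\<Sum>i<length vs. (theta b K \<and>\<^sub>1 dx_all) z
          (vs[i := (\<lambda>c. vec_deriv (vs ! i) (\<lambda>y. total_field j y c) z)]))))"
proof -
  let ?r = "\<lambda>i. take i vs @ drop (Suc i) vs"
  let ?w = "\<lambda>i c. vec_deriv (vs ! i) (\<lambda>y. total_field j y c) z"
  have wb: "?w i (Base k) = 0" for i k
    using fun_cong[OF bracket_total_field[where v = "vs ! i" and j = j and z = z], of "Base k"] by (simp only: coord.case)
  have tw: "theta b K z (?w i) = (vs ! i) (Fib b (add_mset j K))" for i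
    using bracket_total_field[where v = "vs ! i" and j = j and z = z] by (simp add: theta_def dx_def)
  \<comment> \<open>The bracket has no base components, so it contributes only in the slot of the contact form.\<close>
  have bracket: "(theta b K \<and>\<^sub>1 dx_all) z (vs[i := ?w i]) =
      (- 1) ^ i * (vs ! i) (Fib b (add_mset j K)) * dx_all z (?r i)" if i: "i < length vs" for i
  proof -
    have "dx_all z (take k (vs[i := ?w i]) @ drop (Suc k) (vs[i := ?w i])) = 0"
      if "k < length vs" "k \<noteq> i" for k
    proof (rule dx_all_zero_base[of "?w i"])
      show "?w i \<in> set (take k (vs[i := ?w i]) @ drop (Suc k) (vs[i := ?w i]))"
        using that i by (cases "i < k") (auto simp: take_update_swap drop_update_swap set_update_memI)
    qed (rule wb)
    then have "(theta b K \<and>\<^sub>1 dx_all) z (vs[i := ?w i]) =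
        (\<Sum>k\<in>{i}. (- 1) ^ k * theta b K z (vs[i := ?w i] ! k) *
          dx_all z (take k (vs[i := ?w i]) @ drop (Suc k) (vs[i := ?w i])))"
      unfolding wedge_def using i by (intro sum.mono_neutral_right) auto
    then show ?thesis using i by (simp add: tw)
  qed
  have "has_vec_deriv (total_field j z)
      (\<lambda>y. \<Sum>i<length vs. (- 1) ^ i * dx_all z (?r i) * theta b K y (vs ! i)) z
      (\<Sum>i<length vs. (- 1) ^ i * dx_all z (?r i) *
        (theta b (add_mset j K) z (vs ! i) - (vs ! i) (Fib b (add_mset j K))))"
    by (intro has_vec_deriv_sum has_vec_deriv_cmult has_vec_deriv_theta)
  also have "(\<lambda>y. \<Sum>i<length vs. (- 1) ^ i * dx_all z (?r i) * theta b K y (vs ! i)) =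
      (\<lambda>y. (theta b K \<and>\<^sub>1 dx_all) y vs)"
    unfolding wedge_def
  proof (intro ext sum.cong refl)
    fix y i
    show "(- 1) ^ i * dx_all z (?r i) * theta b K y (vs ! i) =
        (- 1) ^ i * theta b K y (vs ! i) * dx_all y (?r i)"
      using dx_all_const[of z "?r i" y] by simp
  qed
  also have "(\<Sum>i<length vs. (- 1) ^ i * dx_all z (?r i) *
        (theta b (add_mset j K) z (vs ! i) - (vs ! i) (Fib b (add_mset j K)))) =
      (theta b (add_mset j K) \<and>\<^sub>1 dx_all) z vs - (\<Sum>i<length vs. (theta b K \<and>\<^sub>1 dx_all) z (vs[i := ?w i]))"
    unfolding wedge_def[of _ _ _ vs] sum_subtractf[symmetric]
    by (intro sum.cong refl) (simp add: bracket algebra_simps)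
  finally show ?thesis by (rule has_vec_deriv_mult[OF f])
qed

text \<open>
  The \<open>(n+1)\<close>-forms \<open>\<Sum> C\<^sup>K\<^sub>b \<theta>\<^sup>b\<^sub>K \<and> dx\<close> that arise as contractions. One bound \<open>m\<close> on the order is kept
  for all iterated derivatives, and the coefficients carry the information on the actual order.
\<close>

definition theta_comb ::
    "nat \<Rightarrow> ('m \<Rightarrow> 'n multiset \<Rightarrow> ('n, 'm) jet \<Rightarrow> real) \<Rightarrow> ('n::{finite,linorder}, 'm::finite) form" where
  "theta_comb m C z vs =
     (\<Sum>b\<in>UNIV. \<Sum>K\<in>{K. size K \<le> m}. C b K z * (theta b K \<and>\<^sub>1 dx_all) z vs)"

definition coeff_total_deriv ::
    "((real ^ 'n::finite) \<times> (real ^ 'm::finite)) set \<Rightarrow> 'n \<Rightarrow>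
      ('m \<Rightarrow> 'n multiset \<Rightarrow> ('n, 'm) jet \<Rightarrow> real) \<Rightarrow> 'm \<Rightarrow> 'n multiset \<Rightarrow> ('n, 'm) jet \<Rightarrow> real" where
  "coeff_total_deriv W j C b K z =
     fun_total_deriv W j (C b K) z + (if j \<in># K then C b (K - {#j#}) z else 0)"

text \<open>
  Reindexing by \<open>K \<mapsto> Kj\<close>. Since multi-indices are unordered, every \<open>K\<close> containing \<open>j\<close> arises exactly once,
  whatever the multiplicity of \<open>j\<close> in it.
\<close>

lemma sum_multiset_shift:
  fixes G :: "'n::finite multiset \<Rightarrow> real"
  assumes "\<And>K. size K = m \<Longrightarrow> c K = 0"
  shows "(\<Sum>K\<in>{K. size K \<le> m}. c K * G (add_mset j K)) =
         (\<Sum>K\<in>{K. size K \<le> m}. (if j \<in># K then c (K - {#j#}) else 0) * G K)"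
proof -
  have remove: "size (K - {#j#}) < m" if "size K \<le> m" "j \<in># K" for K
    using that size_Diff1_less[of j K] by linarith
  have "(\<Sum>K\<in>{K. size K \<le> m}. c K * G (add_mset j K)) =
      (\<Sum>K\<in>{K. size K < m}. c K * G (add_mset j K))"
    by (intro sum.mono_neutral_right finite_multisets_size_le) (auto simp: assms)
  also have "\<dots> = (\<Sum>K\<in>{K. size K \<le> m \<and> j \<in># K}. c (K - {#j#}) * G K)"
    by (rule sum.reindex_bij_witness[of _ "\<lambda>K. K - {#j#}" "add_mset j"])
       (auto simp: remove)
  also have "\<dots> = (\<Sum>K\<in>{K. size K \<le> m}. (if j \<in># K then c (K - {#j#}) else 0) * G K)"
    by (intro sum.mono_neutral_cong_left finite_multisets_size_le) auto
  finally show ?thesis .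
qed

lemma total_deriv_theta_comb:
  assumes W: "open W" and z: "z \<in> jet_space W"
    and C: "\<And>b K. C b K \<in> smooth_funs W" "\<And>b K. size K \<ge> m \<Longrightarrow> C b K = (\<lambda>z. 0)"
  shows "total_deriv j (theta_comb m C) z vs = theta_comb m (coeff_total_deriv W j C) z vs"
proof -
  let ?S = "{K :: 'a multiset. size K \<le> m}"
  let ?\<tau> = "\<lambda>b K vs. (theta b K \<and>\<^sub>1 dx_all) z vs"
  let ?w = "\<lambda>i c. vec_deriv (vs ! i) (\<lambda>y. total_field j y c) z"
  let ?D = "\<lambda>b K. fun_total_deriv W j (C b K) z"
  have D: "has_vec_deriv (total_field j z) (C b K) z (?D b K)" for b K
    using smooth_funs_has_vec_deriv[OF W C(1) z] z by (simp add: fun_total_deriv_def)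
  have "vec_deriv (total_field j z) (\<lambda>y. theta_comb m C y vs) z =
      (\<Sum>b\<in>UNIV. \<Sum>K\<in>?S. ?D b K * ?\<tau> b K vs + C b K z *
         (?\<tau> b (add_mset j K) vs - (\<Sum>i<length vs. ?\<tau> b K (vs[i := ?w i]))))"
    unfolding theta_comb_def
    by (intro has_vec_deriv_imp_vec_deriv has_vec_deriv_sum total_deriv_theta_dx_all D)
  moreover have "(\<Sum>i<length vs. theta_comb m C z (vs[i := ?w i])) =
      (\<Sum>b\<in>UNIV. \<Sum>K\<in>?S. C b K z * (\<Sum>i<length vs. ?\<tau> b K (vs[i := ?w i])))"
    unfolding theta_comb_def sum_distrib_left
    by (subst sum.swap, rule sum.cong[OF refl], subst sum.swap, rule refl)
  ultimately have "total_deriv j (theta_comb m C) z vs =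
      (\<Sum>b\<in>UNIV. (\<Sum>K\<in>?S. ?D b K * ?\<tau> b K vs) + (\<Sum>K\<in>?S. C b K z * ?\<tau> b (add_mset j K) vs))"
    unfolding total_deriv_def lie_deriv_def
    by (simp add: sum.distrib[symmetric] algebra_simps)
  also have "\<dots> = (\<Sum>b\<in>UNIV. (\<Sum>K\<in>?S. ?D b K * ?\<tau> b K vs) +
      (\<Sum>K\<in>?S. (if j \<in># K then C b (K - {#j#}) z else 0) * ?\<tau> b K vs))"
    by (subst sum_multiset_shift) (simp_all add: C(2))
  also have "\<dots> = theta_comb m (coeff_total_deriv W j C) z vs"
    by (simp add: theta_comb_def coeff_total_deriv_def sum.distrib[symmetric] distrib_right)
  finally show ?thesis .
qed

lemma total_deriv_cong:
  assumes "open W" "z \<in> jet_space W" "\<And>y ws. y \<in> jet_space W \<Longrightarrow> \<omega> y ws = \<eta> y ws"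
  shows "total_deriv j \<omega> z vs = total_deriv j \<eta> z vs"
  unfolding total_deriv_def lie_deriv_def vec_deriv_def
  using coord_deriv_cong[OF assms(1,2), of "\<lambda>y. \<omega> y vs" "\<lambda>y. \<eta> y vs"] assms by simp

text \<open>
  The coefficients of \<open>\<Sum> f\<^sub>b \<theta>\<^sup>b \<and> dx\<close>.
\<close>

abbreviation underived :: "('m \<Rightarrow> ('n, 'm) jet \<Rightarrow> real) \<Rightarrow> 'm \<Rightarrow> 'n multiset \<Rightarrow> ('n, 'm) jet \<Rightarrow> real" where
  "underived f \<equiv> (\<lambda>b K z. if K = {#} then f b z else 0)"

lemma iterated_coeff_Cons:
  "foldr (coeff_total_deriv W) (j # js) C b K =
     (\<lambda>z. fun_total_deriv W j (foldr (coeff_total_deriv W) js C b K) z +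
        (if j \<in># K then foldr (coeff_total_deriv W) js C b (K - {#j#}) z else 0))"
  by (simp add: coeff_total_deriv_def[of W j] fun_eq_iff)

lemma iterated_coeff_smooth:
  assumes W: "open W" and f: "\<And>b. f b \<in> smooth_funs W"
  shows "foldr (coeff_total_deriv W) js (underived f) b K \<in> smooth_funs W"
proof (induction js arbitrary: b K)
  case Nil
  show ?case using f by (cases "K = {#}") (auto simp: smooth_funs_zero)
next
  case (Cons j js)
  let ?C = "foldr (coeff_total_deriv W) js (underived f)"
  have "(\<lambda>z. if j \<in># K then ?C b (K - {#j#}) z else 0) \<in> smooth_funs W"
    using Cons.IH by (cases "j \<in># K") (auto simp: smooth_funs_zero)
  then show ?case
    unfolding iterated_coeff_Cons
    by (intro smooth_funs_add smooth_funs_fun_total_deriv W Cons.IH)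
qed

text \<open>
  The principal part: each total derivative raises the order of the contact forms by at most one,
  and the highest order is reached only if all derivatives fall on the contact form. By the case
  \<open>length js < size K\<close> the coefficients above that order vanish.
\<close>

lemma iterated_coeff_top:
  assumes "length js \<le> size K"
  shows "foldr (coeff_total_deriv W) js (underived f) b K = (\<lambda>z. if K = mset js then f b z else 0)"
  using assms
proof (induction js arbitrary: K)
  case (Cons j js)
  let ?C = "foldr (coeff_total_deriv W) js (underived f)"
  have "K \<noteq> mset js" using Cons.prems by auto
  then have "?C b K = (\<lambda>z. 0)" using Cons by simp
  then have 1: "fun_total_deriv W j (?C b K) z = 0" for z by (simp add: fun_total_deriv_zero)
  show ?case
  proof (cases "j \<in># K")
    case True
    then have "?C b (K - {#j#}) = (\<lambda>z. if K - {#j#} = mset js then f b z else 0)"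
      using Cons.prems by (intro Cons.IH) (simp add: size_Diff_singleton)
    moreover have "K - {#j#} = mset js \<longleftrightarrow> K = mset (j # js)"
      using True by (metis add_mset_remove_trivial insert_DiffM mset.simps(2))
    ultimately show ?thesis using True by (simp only: iterated_coeff_Cons 1) simp
  next
    case False
    then have "K \<noteq> mset (j # js)" by auto
    then show ?thesis using False by (simp only: iterated_coeff_Cons 1) simp
  qed
qed simp

lemma iterated_total_deriv:
  assumes W: "open W" and f: "\<And>b. f b \<in> smooth_funs W" and z: "z \<in> jet_space W"
    and m: "length js \<le> m"
  shows "foldr total_deriv js (theta_comb m (underived f)) z vs =
         theta_comb m (foldr (coeff_total_deriv W) js (underived f)) z vs"
  using z m
proof (induction js arbitrary: z vs)
  case (Cons j js)
  let ?C = "foldr (coeff_total_deriv W) js (underived f)"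
  have "total_deriv j (foldr total_deriv js (theta_comb m (underived f))) z vs =
      total_deriv j (theta_comb m ?C) z vs"
    using Cons by (intro total_deriv_cong[OF W]) auto
  also have "\<dots> = theta_comb m (coeff_total_deriv W j ?C) z vs"
  proof (rule total_deriv_theta_comb[OF W Cons.prems(1)])
    show "?C b K \<in> smooth_funs W" for b K
      by (rule iterated_coeff_smooth[OF W f])
    show "?C b K = (\<lambda>z. 0)" if "m \<le> size K" for b K
    proof -
      have "length js < size K" using Cons.prems(2) that by simp
      moreover from this have "K \<noteq> mset js" by auto
      ultimately show ?thesis using iterated_coeff_top[of js K W f b] by simp
    qed
  qed
  finally show ?case by simp
qed simp

lemma total_deriv_zero: "foldr total_deriv js (\<lambda>z vs. 0) = (\<lambda>z vs. 0)"
  by (induction js) (auto simp: total_deriv_def lie_deriv_def vec_deriv_def coord_deriv_def)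

lemma theta_comb_add:
  "theta_comb m (\<lambda>b K z. C b K z + C' b K z) z vs = theta_comb m C z vs + theta_comb m C' z vs"
  by (simp add: theta_comb_def sum.distrib distrib_right)

lemma theta_comb_scale: "theta_comb m (\<lambda>b K z. r * C b K z) z vs = r * theta_comb m C z vs"
  by (simp add: theta_comb_def sum_distrib_left mult.assoc)

lemma theta_comb_sum:
  "theta_comb m (\<lambda>b K z. \<Sum>i\<in>S. C i b K z) z vs = (\<Sum>i\<in>S. theta_comb m (C i) z vs)"
  by (induction S rule: infinite_finite_induct) (simp_all add: theta_comb_add, simp_all add: theta_comb_def)

lemma contact_comb_eq_wedge_theta_comb:
  "contact_comb (\<lambda>_. 1) {I. size I \<le> l} A z vs = (\<Sum>a\<in>UNIV. (theta a {#} \<and>\<^sub>1 theta_comb l (A a)) z vs)"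
proof -
  have "(theta a {#} \<and>\<^sub>1 theta_comb l (A a)) z vs =
      (\<Sum>b\<in>UNIV. \<Sum>K\<in>{K. size K \<le> l}. A a b K z * (theta a {#} \<and>\<^sub>1 theta b K \<and>\<^sub>1 dx_all) z vs)" for a
    unfolding theta_comb_def[abs_def] wedge_sum by (simp add: wedge_scale)
  then show ?thesis by (simp add: contact_comb_def)
qed

section \<open>The interior Euler operator on representatives\<close>

lemma sum_mult_delta:
  "finite S \<Longrightarrow> (\<Sum>K\<in>S. c K * (if K = J then t else (0::real))) = (if J \<in> S then c J * t else 0)"
  by (induction S rule: finite_induct) auto

text \<open>
  The first summand comes from contracting the factor \<open>\<theta>\<^sup>a\<close>, the second from contracting \<open>\<theta>\<^sup>b\<^sub>I\<close>.
\<close>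

lemma contract_contact_comb:
  fixes A :: "'m::finite \<Rightarrow> 'm \<Rightarrow> 'n::{finite,linorder} multiset \<Rightarrow> ('n, 'm) jet \<Rightarrow> real"
  shows "contract (coord_vec (Fib a J)) (contact_comb (\<lambda>_. 1) {I. size I \<le> l} A) =
     (\<lambda>z vs. (if J = {#} then theta_comb l (A a) z vs else 0) +
       (if size J \<le> l then theta_comb l (underived (\<lambda>b y. - A b a J y)) z vs else 0))"
proof (intro ext)
  fix z :: "('n, 'm) jet" and vs
  let ?S = "{K :: 'n multiset. size K \<le> l}"
  let ?\<tau> = "\<lambda>b K. (theta b K \<and>\<^sub>1 dx_all) z vs"
  have first: "(\<Sum>b\<in>UNIV. \<Sum>K\<in>?S. A a' b K z * (if a' = a \<and> J = {#} then ?\<tau> b K else 0)) =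
      (if a' = a then if J = {#} then theta_comb l (A a) z vs else 0 else 0)" for a'
    by (simp add: theta_comb_def)
  have second: "(\<Sum>K\<in>?S. - A a' b K z * (if b = a \<and> K = J then ?\<tau> a' {#} else 0)) =
      (if b = a then if size J \<le> l then - A a' a J z * ?\<tau> a' {#} else 0 else 0)" for a' b
  proof (cases "b = a")
    case True
    then show ?thesis
      using sum_mult_delta[OF finite_multisets_size_le[of l], of "\<lambda>K. - A a' a K z" J "?\<tau> a' {#}"]
      by simp
  qed simp
  have third: "theta_comb l (underived (\<lambda>b y. - A b a J y)) z vs = (\<Sum>b\<in>UNIV. - A b a J z * ?\<tau> b {#})"
  proof -
    have "(\<Sum>K\<in>?S. (if K = {#} then - A b a J z else 0) * ?\<tau> b K) = - A b a J z * ?\<tau> b {#}" for b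
      using finite_multisets_size_le[of l] by (subst sum.mono_neutral_right[of _ "{{#}}"]) auto
    then show ?thesis by (simp add: theta_comb_def)
  qed
  have "contract (coord_vec (Fib a J)) (contact_comb (\<lambda>_. 1) ?S A) z vs =
      (\<Sum>a'\<in>UNIV. \<Sum>b\<in>UNIV. \<Sum>K\<in>?S. A a' b K z *
        contract (coord_vec (Fib a J)) (theta a' {#} \<and>\<^sub>1 theta b K \<and>\<^sub>1 dx_all) z vs)"
    by (simp add: contract_def contact_comb_def)
  also have "\<dots> =
      (\<Sum>a'\<in>UNIV. \<Sum>b\<in>UNIV. \<Sum>K\<in>?S. A a' b K z * (if a' = a \<and> J = {#} then ?\<tau> b K else 0)) +
      (\<Sum>a'\<in>UNIV. \<Sum>b\<in>UNIV. \<Sum>K\<in>?S. - A a' b K z * (if b = a \<and> K = J then ?\<tau> a' {#} else 0))"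
    unfolding contract_contact_form sum.distrib[symmetric] by (simp add: right_diff_distrib)
  also have "\<dots> = (if J = {#} then theta_comb l (A a) z vs else 0) +
       (if size J \<le> l then theta_comb l (underived (\<lambda>b y. - A b a J y)) z vs else 0)"
    unfolding first second third by simp
  finally show "contract (coord_vec (Fib a J)) (contact_comb (\<lambda>_. 1) ?S A) z vs =
     (if J = {#} then theta_comb l (A a) z vs else 0) +
       (if size J \<le> l then theta_comb l (underived (\<lambda>b y. - A b a J y)) z vs else 0)" .
qed

text \<open>
  The sum over \<open>J\<close> stops at \<open>|J| = l\<close>. Contracting the factor \<open>\<theta>\<^sup>a\<close> contributes \<open>A\<close> itself;
  at order \<open>l\<close>, the derivatives contribute through \<open>J = I\<close> alone, by their principal part.
\<close>

lemma interior_euler_unit_density: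
  fixes W :: "((real ^ 'n::{finite,linorder}) \<times> (real ^ 'm::finite)) set"
  assumes W: "open W" and A: "\<And>a b I. A a b I \<in> smooth_funs W"
  obtains B where "\<And>a b I. B a b I \<in> smooth_funs W"
    and "interior_euler W (contact_comb (\<lambda>_. 1) {I. size I \<le> l} A) =
           contact_comb (\<lambda>_. 1) {I. size I \<le> l} B"
    and "\<And>a b I z. size I = l \<Longrightarrow> B a b I z = 1 / 2 * (A a b I z + (- 1) ^ (l + 1) * A b a I z)"
proof
  let ?S = "{J :: 'n multiset. size J \<le> l}"
  let ?f = "\<lambda>a J b y. - A b a J y"
  let ?E = "\<lambda>a J. foldr (coeff_total_deriv W) (sorted_list_of_multiset J) (underived (?f a J))"
  let ?B = "\<lambda>a b I z. 1 / 2 * (A a b I z + (\<Sum>J\<in>?S. (- 1) ^ size J * ?E a J b I z))"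
  have len: "length (sorted_list_of_multiset J) = size J" for J :: "'n multiset"
    by (metis mset_sorted_list_of_multiset size_mset)
  have f: "?f a J b \<in> smooth_funs W" for a J b
    using smooth_funs_scale[OF W A, of "- 1"] by simp
  show smooth: "?B a b I \<in> smooth_funs W" for a b I
    by (intro smooth_funs_scale smooth_funs_add smooth_funs_sum iterated_coeff_smooth W A f)
  show "?B a b I z = 1 / 2 * (A a b I z + (- 1) ^ (l + 1) * A b a I z)" if I: "size I = l" for a b I z
  proof -
    have E: "?E a J b I = (\<lambda>z. if I = J then ?f a J b z else 0)" if "J \<in> ?S" for J
      using that I by (subst iterated_coeff_top) (simp_all add: len)
    then have "?E a J b I z = (if J = I then - A b a I z else 0)" if "J \<in> ?S" for J
      unfolding E[OF that] by auto
    then have "(\<Sum>J\<in>?S. (- 1) ^ size J * ?E a J b I z) =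
        (\<Sum>J\<in>?S. (- 1) ^ size J * (if J = I then - A b a I z else 0))"
      by (intro sum.cong) auto
    also have "\<dots> = (if I \<in> ?S then (- 1) ^ size I * - A b a I z else 0)"
      by (rule sum_mult_delta[OF finite_multisets_size_le])
    finally show ?thesis using I by simp
  qed
  let ?\<omega> = "contact_comb (\<lambda>_. 1) ?S A"
  have zero: "neg_total_deriv J (contract (coord_vec (Fib a J)) ?\<omega>) z ws = 0"
    if "\<not> size J \<le> l" for a J z ws
  proof -
    have "J \<noteq> {#}" using that by auto
    then have "contract (coord_vec (Fib a J)) ?\<omega> = (\<lambda>z vs. 0)"
      using that unfolding contract_contact_comb by simp
    then show ?thesis by (simp add: neg_total_deriv_def total_deriv_zero)
  qed
  have summand: "neg_total_deriv J (contract (coord_vec (Fib a J)) ?\<omega>) z ws =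
      (if J = {#} then theta_comb l (A a) z ws else 0) + (- 1) ^ size J * theta_comb l (?E a J) z ws"
    if z: "z \<in> jet_space W" and J: "size J \<le> l" for a J z ws
  proof (cases "J = {#}")
    case True
    show ?thesis unfolding neg_total_deriv_def contract_contact_comb True by simp
  next
    case False
    then have "contract (coord_vec (Fib a J)) ?\<omega> = theta_comb l (underived (?f a J))"
      using J unfolding contract_contact_comb by auto
    then show ?thesis
      using False J by (simp add: neg_total_deriv_def iterated_total_deriv[OF W f z] len)
  qed
  have total: "Sum_any (\<lambda>J. neg_total_deriv J (contract (coord_vec (Fib a J)) ?\<omega>) z ws) =
      2 * theta_comb l (?B a) z ws" if z: "z \<in> jet_space W" for a z ws
  proof -
    have "Sum_any (\<lambda>J. neg_total_deriv J (contract (coord_vec (Fib a J)) ?\<omega>) z ws) =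
        (\<Sum>J\<in>?S. neg_total_deriv J (contract (coord_vec (Fib a J)) ?\<omega>) z ws)"
      using zero by (intro Sum_any.expand_superset finite_multisets_size_le) auto
    also have "\<dots> = (\<Sum>J\<in>?S. (if J = {#} then theta_comb l (A a) z ws else 0)) +
        (\<Sum>J\<in>?S. (- 1) ^ size J * theta_comb l (?E a J) z ws)"
      by (simp add: summand z sum.distrib)
    also have "\<dots> = 2 * theta_comb l (?B a) z ws"
      unfolding theta_comb_scale theta_comb_add theta_comb_sum
      by (simp add: sum.delta[OF finite_multisets_size_le])
    finally show ?thesis .
  qed
  show "interior_euler W ?\<omega> = contact_comb (\<lambda>_. 1) ?S ?B"
  proof (intro ext)
    fix z :: "('n, 'm) jet" and vs
    show "interior_euler W ?\<omega> z vs = contact_comb (\<lambda>_. 1) ?S ?B z vs"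
    proof (cases "z \<in> jet_space W")
      case True
      have "(theta a {#} \<and>\<^sub>1
            (\<lambda>y ws. Sum_any (\<lambda>J. neg_total_deriv J (contract (coord_vec (Fib a J)) ?\<omega>) y ws))) z vs =
          2 * (theta a {#} \<and>\<^sub>1 theta_comb l (?B a)) z vs" for a
        by (subst wedge_scale[symmetric], rule wedge_cong, rule total[OF True])
      then show ?thesis
        using True by (simp only: interior_euler_def contact_comb_eq_wedge_theta_comb if_True
          sum_distrib_left[symmetric])
    next
      case False
      then have "?B a b I z = 0" for a b I using smooth by (rule smooth_funs_outside[rotated])
      then show ?thesis using False by (simp only: interior_euler_def contact_comb_def) simp
    qed
  qed
qed

text \<open>
  Passing from one volume form to another rescales the coefficients, and the symbol of the
  interior Euler operator commutes with this rescaling.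
\<close>

lemma contact_comb_density:
  fixes A :: "'m::finite \<Rightarrow> 'm \<Rightarrow> 'n::{finite,linorder} multiset \<Rightarrow> ('n, 'm) jet \<Rightarrow> real"
  shows "contact_comb \<rho> S A = contact_comb (\<lambda>_. 1) S (\<lambda>a b I z. \<rho> (base_pt z) * A a b I z)"
proof -
  have "(theta a {#} \<and>\<^sub>1 theta b I \<and>\<^sub>1 vol \<rho>) z vs =
      \<rho> (base_pt z) * (theta a {#} \<and>\<^sub>1 theta b I \<and>\<^sub>1 dx_all) z vs" for a b :: 'm and I z vs
  proof -
    have "(theta a {#} \<and>\<^sub>1 theta b I \<and>\<^sub>1 vol \<rho>) z vs =
        (theta a {#} \<and>\<^sub>1 (\<lambda>z vs. \<rho> (base_pt z) * (theta b I \<and>\<^sub>1 dx_all) z vs)) z vs"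
      by (rule wedge_cong, subst wedge_scale[symmetric], rule wedge_cong, rule vol_eq_dx_all)
    then show ?thesis by (simp add: wedge_scale)
  qed
  then show ?thesis by (auto simp: contact_comb_def fun_eq_iff mult_ac)
qed

lemma smooth_funs_mult_density:
  assumes W: "open W" and \<rho>: "volume_density W \<rho>" and f: "f \<in> smooth_funs W"
  shows "(\<lambda>z. \<rho> (base_pt z) * f z) \<in> smooth_funs W"
    "(\<lambda>z. inverse (\<rho> (base_pt z)) * f z) \<in> smooth_funs W"
proof -
  have s: "times_differentiable W k (\<lambda>z. \<rho> (base_pt z))" for k
    using \<rho> by (auto simp: volume_density_def smooth_on_jets_iff)
  have nz: "\<rho> (base_pt z) \<noteq> 0" if "z \<in> jet_space W" for z
    using \<rho> that by (force simp: volume_density_def jet_space_def)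
  have o: "jet_order_le W 0 (\<lambda>z. F (\<rho> (base_pt z)))" for F :: "real \<Rightarrow> real"
    by (auto simp: jet_order_le_def base_pt_def)
  show "(\<lambda>z. \<rho> (base_pt z) * f z) \<in> smooth_funs W"
    by (rule smooth_funs_mult[OF W f s o[of "\<lambda>x. x"]])
  show "(\<lambda>z. inverse (\<rho> (base_pt z)) * f z) \<in> smooth_funs W"
    by (rule smooth_funs_mult[OF W f times_differentiable_inverse[OF W s nz] o])
qed

lemma interior_euler_contact_comb:
  assumes W: "open W" and \<rho>: "volume_density W \<rho>" and A: "\<And>a b I. A a b I \<in> smooth_funs W"
  obtains B where "\<And>a b I. B a b I \<in> smooth_funs W"
    and "interior_euler W (contact_comb \<rho> {I. size I \<le> l} A) = contact_comb \<rho> {I. size I \<le> l} B"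
    and "\<And>a b I z. size I = l \<Longrightarrow> B a b I z = 1 / 2 * (A a b I z + (- 1) ^ (l + 1) * A b a I z)"
proof -
  let ?A = "\<lambda>a b I z. \<rho> (base_pt z) * A a b I z"
  have "?A a b I \<in> smooth_funs W" for a b I
    by (rule smooth_funs_mult_density(1)[OF W \<rho> A])
  then obtain B where B: "\<And>a b I. B a b I \<in> smooth_funs W"
    "interior_euler W (contact_comb (\<lambda>_. 1) {I. size I \<le> l} ?A) = contact_comb (\<lambda>_. 1) {I. size I \<le> l} B"
    "\<And>a b I z. size I = l \<Longrightarrow> B a b I z = 1 / 2 * (?A a b I z + (- 1) ^ (l + 1) * ?A b a I z)"
    by (rule interior_euler_unit_density[OF W, of ?A l]) (rule that)
  let ?B = "\<lambda>a b I z. inverse (\<rho> (base_pt z)) * B a b I z"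
  have nz: "\<rho> (base_pt z) \<noteq> 0" if "z \<in> jet_space W" for z
    using \<rho> that by (force simp: volume_density_def jet_space_def)
  show ?thesis
  proof (rule that[of ?B])
    show "?B a b I \<in> smooth_funs W" for a b I
      by (rule smooth_funs_mult_density(2)[OF W \<rho> B(1)])
    have "\<rho> (base_pt z) * ?B a b I z = B a b I z" for a b I z
      using nz[of z] smooth_funs_outside[OF B(1), of z] by (cases "z \<in> jet_space W") auto
    then show "interior_euler W (contact_comb \<rho> {I. size I \<le> l} A) = contact_comb \<rho> {I. size I \<le> l} ?B"
      unfolding contact_comb_density[of \<rho>] B(2) by (simp only:)
    show "?B a b I z = 1 / 2 * (A a b I z + (- 1) ^ (l + 1) * A b a I z)" if "size I = l" for a b I z
      using nz[of z] smooth_funs_outside[OF A, of z] smooth_funs_outside[OF B(1), of z] B(3)[OF that]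
      by (cases "z \<in> jet_space W") (auto simp: field_simps)
  qed
qed

section \<open>Classes in the graded pieces\<close>

lemma filt_nat: "filt W \<rho> (int l) =
    {contact_comb \<rho> {I. size I \<le> l} A | A. \<forall>a b I. A a b I \<in> smooth_funs W}"
  by (simp add: filt_def)

lemma filt_pred: "filt W \<rho> (int l - 1) =
    {contact_comb \<rho> {I. size I < l} A | A. \<forall>a b I. A a b I \<in> smooth_funs W}"
proof -
  have "{I :: 'a multiset. int (size I) \<le> int l - 1} = {I. size I < l}" by auto
  then show ?thesis by (simp only: filt_def)
qed

lemma contact_comb_lincomb:
  "contact_comb \<rho> S (\<lambda>a b I z. r * A a b I z + s * B a b I z) z vs =
     r * contact_comb \<rho> S A z vs + s * contact_comb \<rho> S B z vs"
  by (simp add: contact_comb_def sum_distrib_left sum.distrib[symmetric] algebra_simps)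

lemma filt_lincomb:
  assumes "open W" "\<omega> \<in> filt W \<rho> l" "\<eta> \<in> filt W \<rho> l"
  shows "(\<lambda>z vs. r * \<omega> z vs + s * \<eta> z vs) \<in> filt W \<rho> l"
proof -
  from assms(2,3) obtain A B where A: "\<And>a b I. A a b I \<in> smooth_funs W"
      "\<omega> = contact_comb \<rho> {I. int (size I) \<le> l} A"
    and B: "\<And>a b I. B a b I \<in> smooth_funs W" "\<eta> = contact_comb \<rho> {I. int (size I) \<le> l} B"
    unfolding filt_def by blast
  have "(\<lambda>z. r * A a b I z + s * B a b I z) \<in> smooth_funs W" for a b I
    by (intro smooth_funs_add smooth_funs_scale assms(1) A(1) B(1))
  moreover have "(\<lambda>z vs. r * \<omega> z vs + s * \<eta> z vs) =
      contact_comb \<rho> {I. int (size I) \<le> l} (\<lambda>a b I z. r * A a b I z + s * B a b I z)"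
    unfolding contact_comb_lincomb A(2) B(2) ..
  ultimately show ?thesis unfolding filt_def by blast
qed

lemma zero_in_filt: "(\<lambda>z vs. 0) \<in> filt W \<rho> l"
proof -
  have "(\<lambda>z vs. 0) = contact_comb \<rho> {I. int (size I) \<le> l} (\<lambda>a b I z. 0)"
    by (simp add: contact_comb_def fun_eq_iff)
  then show ?thesis unfolding filt_def using smooth_funs_zero by blast
qed

lemma equiv_gr_rel:
  assumes W: "open W"
  shows "equiv (filt W \<rho> (int l)) (gr_rel W \<rho> l)"
proof (rule equivI)
  show "gr_rel W \<rho> l \<subseteq> filt W \<rho> (int l) \<times> filt W \<rho> (int l)" by (auto simp: gr_rel_def)
  show "refl_on (filt W \<rho> (int l)) (gr_rel W \<rho> l)"
    by (auto simp: refl_on_def gr_rel_def zero_in_filt)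
  show "sym (gr_rel W \<rho> l)"
  proof (rule symI)
    fix \<omega> \<eta> assume "(\<omega>, \<eta>) \<in> gr_rel W \<rho> l"
    then show "(\<eta>, \<omega>) \<in> gr_rel W \<rho> l"
      using filt_lincomb[OF W, of "\<lambda>z vs. \<omega> z vs - \<eta> z vs" \<rho> "int l - 1" _ "- 1" 0]
      by (auto simp: gr_rel_def)
  qed
  show "trans (gr_rel W \<rho> l)"
  proof (rule transI)
    fix \<omega> \<eta> \<zeta> assume "(\<omega>, \<eta>) \<in> gr_rel W \<rho> l" "(\<eta>, \<zeta>) \<in> gr_rel W \<rho> l"
    then show "(\<omega>, \<zeta>) \<in> gr_rel W \<rho> l"
      using filt_lincomb[OF W, of "\<lambda>z vs. \<omega> z vs - \<eta> z vs" \<rho> "int l - 1"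
          "\<lambda>z vs. \<eta> z vs - \<zeta> z vs" 1 1]
      by (auto simp: gr_rel_def)
  qed
qed

lemma contact_comb_le_split:
  fixes A :: "'m::finite \<Rightarrow> 'm \<Rightarrow> 'n::{finite,linorder} multiset \<Rightarrow> ('n, 'm) jet \<Rightarrow> real"
  shows "contact_comb \<rho> {I. size I \<le> l} A z vs =
     contact_comb \<rho> {I. size I < l} A z vs + contact_comb \<rho> {I. size I = l} A z vs"
proof -
  have "{I :: 'n multiset. size I \<le> l} = {I. size I < l} \<union> {I. size I = l}" by auto
  moreover have "finite {I :: 'n multiset. size I < l}" "finite {I :: 'n multiset. size I = l}"
    by (rule finite_subset[OF _ finite_multisets_size_le[of l]]; force)+
  ultimately show ?thesis
    unfolding contact_comb_def sum.distrib[symmetric]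
    by (intro sum.cong refl) (simp, subst sum.union_disjoint, auto)
qed

text \<open>
  Coefficients of other orders are unconstrained in \<open>smooth_coeffs\<close>; setting them to zero gives a
  representative with smooth coefficients throughout.
\<close>

lemma contact_comb_homogeneous_eq:
  "contact_comb \<rho> {I. size I = l} A =
     contact_comb \<rho> {I. size I \<le> l} (\<lambda>a b I z. if size I = l then A a b I z else 0)"
proof (intro ext)
  fix z vs
  show "contact_comb \<rho> {I. size I = l} A z vs =
     contact_comb \<rho> {I. size I \<le> l} (\<lambda>a b I z. if size I = l then A a b I z else 0) z vs"
    unfolding contact_comb_le_split by (simp add: contact_comb_def)
qed

lemma contact_comb_homogeneous_in_filt:
  assumes "A \<in> smooth_coeffs W l"
  shows "contact_comb \<rho> {I. size I = l} A \<in> filt W \<rho> (int l)"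
proof -
  have "(\<lambda>z. if size I = l then A a b I z else 0) \<in> smooth_funs W" for a b I
    using assms by (cases "size I = l") (auto simp: smooth_coeffs_def smooth_funs_zero)
  then show ?thesis unfolding contact_comb_homogeneous_eq filt_nat by blast
qed

lemma gr_elem_in_gr: "A \<in> smooth_coeffs W l \<Longrightarrow> gr_elem W \<rho> l A \<in> gr W \<rho> l"
  unfolding gr_elem_def gr_class_def gr_def by (intro quotientI contact_comb_homogeneous_in_filt)

lemma gr_class_eq_gr_elem:
  assumes W: "open W" and A: "\<And>a b I. A a b I \<in> smooth_funs W"
    and top: "\<And>a b I z. size I = l \<Longrightarrow> A a b I z = A' a b I z"
  shows "gr_class W \<rho> l (contact_comb \<rho> {I. size I \<le> l} A) = gr_elem W \<rho> l A'"
proof -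
  have "contact_comb \<rho> {I. size I = l} A' = contact_comb \<rho> {I. size I = l} A"
    by (simp add: contact_comb_def fun_eq_iff top)
  moreover have "(contact_comb \<rho> {I. size I \<le> l} A, contact_comb \<rho> {I. size I = l} A) \<in> gr_rel W \<rho> l"
    unfolding gr_rel_def contact_comb_le_split filt_pred
    using A contact_comb_homogeneous_in_filt[of A W l \<rho>]
    by (auto simp: filt_nat smooth_coeffs_def contact_comb_le_split[abs_def])
  ultimately show ?thesis
    unfolding gr_elem_def gr_class_def
    using equiv_class_eq[OF equiv_gr_rel[OF W]] by metis
qed

lemma gr_elem_cong:
  "(\<And>a b I z. size I = l \<Longrightarrow> A a b I z = A' a b I z) \<Longrightarrow> gr_elem W \<rho> l A = gr_elem W \<rho> l A'"
  unfolding gr_elem_def by (rule arg_cong[where f = "gr_class W \<rho> l"]) (simp add: contact_comb_def fun_eq_iff)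

abbreviation (input) euler_symbol ::
    "nat \<Rightarrow> ('m \<Rightarrow> 'm \<Rightarrow> 'n multiset \<Rightarrow> ('n, 'm) jet \<Rightarrow> real) \<Rightarrow>
      'm \<Rightarrow> 'm \<Rightarrow> 'n multiset \<Rightarrow> ('n, 'm) jet \<Rightarrow> real" where
  "euler_symbol l A \<equiv> (\<lambda>a b I z. 1 / 2 * (A a b I z + (- 1) ^ (l + 1) * A b a I z))"

lemma gr_class_interior_euler:
  assumes W: "open W" and \<rho>: "volume_density W \<rho>" and A: "\<And>a b I. A a b I \<in> smooth_funs W"
  shows "interior_euler W (contact_comb \<rho> {I. size I \<le> l} A) \<in> filt W \<rho> (int l)"
    and "gr_class W \<rho> l (interior_euler W (contact_comb \<rho> {I. size I \<le> l} A)) =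
           gr_elem W \<rho> l (euler_symbol l A)"
proof -
  obtain B where B: "\<And>a b I. B a b I \<in> smooth_funs W"
    "interior_euler W (contact_comb \<rho> {I. size I \<le> l} A) = contact_comb \<rho> {I. size I \<le> l} B"
    "\<And>a b I z. size I = l \<Longrightarrow> B a b I z = euler_symbol l A a b I z"
    by (rule interior_euler_contact_comb[OF W \<rho> A, of l]) (rule that)
  show "interior_euler W (contact_comb \<rho> {I. size I \<le> l} A) \<in> filt W \<rho> (int l)"
    unfolding B(2) filt_nat using B(1) by blast
  show "gr_class W \<rho> l (interior_euler W (contact_comb \<rho> {I. size I \<le> l} A)) =
      gr_elem W \<rho> l (euler_symbol l A)"
    unfolding B(2) using W B(1,3) by (rule gr_class_eq_gr_elem)
qed

text \<open>
  The two forms have representatives whose coefficients of order \<open>l\<close> coincide, and the class of the image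
  depends only on these.
\<close>

lemma interior_euler_respects_gr_rel:
  assumes W: "open W" and \<rho>: "volume_density W \<rho>" and rel: "(\<omega>, \<eta>) \<in> gr_rel W \<rho> l"
  shows "gr_class W \<rho> l (interior_euler W \<omega>) = gr_class W \<rho> l (interior_euler W \<eta>)"
proof -
  from rel have "\<eta> \<in> filt W \<rho> (int l)" "(\<lambda>z vs. \<omega> z vs - \<eta> z vs) \<in> filt W \<rho> (int l - 1)"
    by (auto simp: gr_rel_def)
  then obtain A D where A: "\<And>a b I. A a b I \<in> smooth_funs W" "\<eta> = contact_comb \<rho> {I. size I \<le> l} A"
    and D: "\<And>a b I. D a b I \<in> smooth_funs W"
      "(\<lambda>z vs. \<omega> z vs - \<eta> z vs) = contact_comb \<rho> {I. size I < l} D"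
    unfolding filt_nat filt_pred by blast
  let ?D = "\<lambda>a b I z. if size I < l then D a b I z else 0"
  let ?A = "\<lambda>a b I z. 1 * A a b I z + 1 * ?D a b I z"
  have "?D a b I \<in> smooth_funs W" for a b I
    using D(1) by (cases "size I < l") (auto simp: smooth_funs_zero)
  then have smooth: "?A a b I \<in> smooth_funs W" for a b I
    by (intro smooth_funs_add smooth_funs_scale W A(1))
  have \<omega>: "\<omega> = contact_comb \<rho> {I. size I \<le> l} ?A"
  proof (intro ext)
    fix z vs
    have "\<omega> z vs = \<eta> z vs + contact_comb \<rho> {I. size I < l} D z vs"
      using fun_cong[OF fun_cong[OF D(2)], of z vs] by simp
    also have "contact_comb \<rho> {I. size I < l} D z vs = contact_comb \<rho> {I. size I \<le> l} ?D z vs"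
      unfolding contact_comb_le_split by (simp add: contact_comb_def)
    finally show "\<omega> z vs = contact_comb \<rho> {I. size I \<le> l} ?A z vs"
      unfolding contact_comb_lincomb A(2) by simp
  qed
  have "gr_class W \<rho> l (interior_euler W \<omega>) = gr_elem W \<rho> l (euler_symbol l ?A)"
    unfolding \<omega> by (rule gr_class_interior_euler(2)[OF W \<rho> smooth])
  also have "\<dots> = gr_elem W \<rho> l (euler_symbol l A)"
    by (rule gr_elem_cong) simp
  also have "\<dots> = gr_class W \<rho> l (interior_euler W \<eta>)"
    unfolding A(2) by (rule gr_class_interior_euler(2)[OF W \<rho> A(1), symmetric])
  finally show ?thesis .
qed

lemma gr_euler_gr_class:
  assumes W: "open W" and \<rho>: "volume_density W \<rho>" and \<omega>: "\<omega> \<in> filt W \<rho> (int l)"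
  shows "gr_euler W \<rho> l (gr_class W \<rho> l \<omega>) = gr_class W \<rho> l (interior_euler W \<omega>)"
proof -
  have "gr_class W \<rho> l (interior_euler W \<eta>) = gr_class W \<rho> l (interior_euler W \<omega>)"
    if "\<eta> \<in> gr_class W \<rho> l \<omega>" for \<eta>
    using interior_euler_respects_gr_rel[OF W \<rho>, of \<omega> \<eta> l] that by (simp add: gr_class_def)
  moreover have "\<omega> \<in> gr_class W \<rho> l \<omega>"
    unfolding gr_class_def by (rule equiv_class_self[OF equiv_gr_rel[OF W] \<omega>])
  ultimately show ?thesis unfolding gr_euler_def by blast
qed

lemma gr_euler_gr_elem:
  assumes W: "open W" and \<rho>: "volume_density W \<rho>" and A: "A \<in> smooth_coeffs W l"
  shows "gr_euler W \<rho> l (gr_elem W \<rho> l A) = gr_elem W \<rho> l (euler_symbol l A)"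
proof -
  let ?A = "\<lambda>a b I z. if size I = l then A a b I z else 0"
  have smooth: "?A a b I \<in> smooth_funs W" for a b I
    using A by (cases "size I = l") (auto simp: smooth_coeffs_def smooth_funs_zero)
  have "gr_euler W \<rho> l (gr_elem W \<rho> l A) =
      gr_class W \<rho> l (interior_euler W (contact_comb \<rho> {I. size I = l} A))"
    unfolding gr_elem_def by (intro gr_euler_gr_class W \<rho> contact_comb_homogeneous_in_filt A)
  also have "\<dots> = gr_elem W \<rho> l (euler_symbol l ?A)"
    unfolding contact_comb_homogeneous_eq[of \<rho> l A] by (rule gr_class_interior_euler(2)[OF W \<rho> smooth])
  also have "\<dots> = gr_elem W \<rho> l (euler_symbol l A)"
    by (rule gr_elem_cong) simp
  finally show ?thesis .
qed

lemma gr_eq_gr_elems: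
  assumes "open W"
  shows "gr W \<rho> l = gr_elem W \<rho> l ` smooth_coeffs W l"
proof (intro equalityI subsetI)
  fix C assume "C \<in> gr W \<rho> l"
  then obtain \<omega> where "\<omega> \<in> filt W \<rho> (int l)" "C = gr_class W \<rho> l \<omega>"
    unfolding gr_def gr_class_def by (auto elim: quotientE)
  then obtain A where "\<And>a b I. A a b I \<in> smooth_funs W"
    "C = gr_class W \<rho> l (contact_comb \<rho> {I. size I \<le> l} A)"
    unfolding filt_nat by blast
  then show "C \<in> gr_elem W \<rho> l ` smooth_coeffs W l"
    using gr_class_eq_gr_elem[OF assms, of A l A \<rho>] by (auto simp: smooth_coeffs_def)
qed (auto simp: gr_elem_in_gr)

lemma smooth_coeffs_flip_lincomb:
  assumes "open W" "A \<in> smooth_coeffs W l"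
  shows "(\<lambda>a b I z. r * (A a b I z + s * A b a I z)) \<in> smooth_coeffs W l"
  using assms unfolding smooth_coeffs_def
  by (auto intro!: smooth_funs_scale smooth_funs_add)

lemma gr_elem_zero: "gr_elem W \<rho> l (\<lambda>a b I z. 0) = gr_class W \<rho> l (\<lambda>z vs. 0)"
  unfolding gr_elem_def by (rule arg_cong[where f = "gr_class W \<rho> l"]) (simp add: contact_comb_def fun_eq_iff)

text \<open>
  Needed for the kernel: the coefficients of a class cannot be compared directly, as they are not
  unique for \<open>l = 0\<close>, but a summand representing zero can be dropped.
\<close>

lemma gr_elem_add_zero_class:
  assumes W: "open W" and A: "A \<in> smooth_coeffs W l" and B: "B \<in> smooth_coeffs W l"
    and zero: "gr_elem W \<rho> l B = gr_class W \<rho> l (\<lambda>z vs. 0)"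
  shows "gr_elem W \<rho> l (\<lambda>a b I z. A a b I z + B a b I z) = gr_elem W \<rho> l A"
proof -
  let ?c = "contact_comb \<rho> {I. size I = l}"
  have "(?c B, \<lambda>z vs. 0) \<in> gr_rel W \<rho> l"
    using zero eq_equiv_class_iff[OF equiv_gr_rel[OF W] contact_comb_homogeneous_in_filt[OF B] zero_in_filt]
    unfolding gr_elem_def gr_class_def by simp
  then have "?c B \<in> filt W \<rho> (int l - 1)" by (simp add: gr_rel_def)
  moreover have "?c (\<lambda>a b I z. A a b I z + B a b I z) z vs = ?c A z vs + ?c B z vs" for z vs
    using contact_comb_lincomb[of \<rho> _ 1 A 1 B] by simp
  moreover have "(\<lambda>a b I z. A a b I z + B a b I z) \<in> smooth_coeffs W l"
    using A B by (auto simp: smooth_coeffs_def intro!: smooth_funs_add W)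
  ultimately have "(?c (\<lambda>a b I z. A a b I z + B a b I z), ?c A) \<in> gr_rel W \<rho> l"
    by (simp add: gr_rel_def contact_comb_homogeneous_in_filt A)
  then show ?thesis
    unfolding gr_elem_def gr_class_def by (rule equiv_class_eq[OF equiv_gr_rel[OF W]])
qed

theorem corollary5p1:
  fixes W :: "((real ^ 'n::{finite,linorder}) \<times> (real ^ 'm::finite)) set"
    and \<rho> :: "real ^ 'n::{finite,linorder} \<Rightarrow> real"
    and l :: nat
  assumes "open W"
    and "volume_density W \<rho>"
  shows
    "(\<forall>\<omega> \<in> filt W \<rho> (int l). interior_euler W \<omega> \<in> filt W \<rho> (int l) \<and>
        gr_euler W \<rho> l (gr_class W \<rho> l \<omega>) = gr_class W \<rho> l (interior_euler W \<omega>)) \<and>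
     (\<forall>A \<in> smooth_coeffs W l.
        gr_euler W \<rho> l (gr_elem W \<rho> l A) =
        gr_elem W \<rho> l (\<lambda>a b I z. 1 / 2 * (A a b I z + (- 1) ^ (l + 1) * A b a I z))) \<and>
     gr_euler W \<rho> l ` gr W \<rho> l =
       {gr_elem W \<rho> l A | A. A \<in> smooth_coeffs W l \<and>
          (\<forall>a b I z. size I = l \<longrightarrow> A a b I z = (- 1) ^ (l + 1) * A b a I z)} \<and>
     {C \<in> gr W \<rho> l. gr_euler W \<rho> l C = gr_class W \<rho> l (\<lambda>z vs. 0)} =
       {gr_elem W \<rho> l A | A. A \<in> smooth_coeffs W l \<and>
          (\<forall>a b I z. size I = l \<longrightarrow> A a b I z = (- 1) ^ l * A b a I z)}"
proof (intro conjI)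
  note formula = gr_euler_gr_elem[OF assms]
  note classes = gr_eq_gr_elems[OF assms(1)]
  have sq: "(- 1) ^ l * ((- 1) ^ l * x) = (x::real)" for x
    by (simp flip: mult.assoc power_mult_distrib)
  show "\<forall>\<omega> \<in> filt W \<rho> (int l). interior_euler W \<omega> \<in> filt W \<rho> (int l) \<and>
      gr_euler W \<rho> l (gr_class W \<rho> l \<omega>) = gr_class W \<rho> l (interior_euler W \<omega>)"
    using gr_class_interior_euler(1)[OF assms] gr_euler_gr_class[OF assms]
    by (auto simp: filt_nat)
  show "\<forall>A \<in> smooth_coeffs W l. gr_euler W \<rho> l (gr_elem W \<rho> l A) = gr_elem W \<rho> l (euler_symbol l A)"
    using formula by blast
  let ?im = "{A \<in> smooth_coeffs W l. \<forall>a b I z. size I = l \<longrightarrow> A a b I z = (- 1) ^ (l + 1) * A b a I z}"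
  let ?ker = "{A \<in> smooth_coeffs W l. \<forall>a b I z. size I = l \<longrightarrow> A a b I z = (- 1) ^ l * A b a I z}"
  have "gr_euler W \<rho> l ` gr W \<rho> l = gr_elem W \<rho> l ` ?im"
  proof (intro equalityI subsetI)
    fix C assume "C \<in> gr_euler W \<rho> l ` gr W \<rho> l"
    then obtain A where A: "A \<in> smooth_coeffs W l" and C: "C = gr_elem W \<rho> l (euler_symbol l A)"
      using formula unfolding classes by auto
    have "euler_symbol l A a b I z = (- 1) ^ (l + 1) * euler_symbol l A b a I z" for a b I z
      by (simp add: algebra_simps sq)
    then have "euler_symbol l A \<in> ?im"
      using smooth_coeffs_flip_lincomb[OF assms(1) A] by blast
    then show "C \<in> gr_elem W \<rho> l ` ?im" unfolding C by (rule imageI)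
  next
    fix C assume "C \<in> gr_elem W \<rho> l ` ?im"
    then obtain A where A: "A \<in> ?im" and C: "C = gr_elem W \<rho> l A" by blast
    have flip: "(- 1) ^ (l + 1) * A b a I z = A a b I z" if "size I = l" for a b I z
      by (rule sym) (use A that in blast)
    have "C = gr_elem W \<rho> l (euler_symbol l A)"
      unfolding C by (intro gr_elem_cong) (simp only: flip, simp)
    then show "C \<in> gr_euler W \<rho> l ` gr W \<rho> l"
      using formula[of A l] gr_elem_in_gr[of A W l \<rho>] A by (metis (no_types, lifting) imageI mem_Collect_eq)
  qed
  then show "gr_euler W \<rho> l ` gr W \<rho> l =
       {gr_elem W \<rho> l A | A. A \<in> smooth_coeffs W l \<and>
          (\<forall>a b I z. size I = l \<longrightarrow> A a b I z = (- 1) ^ (l + 1) * A b a I z)}"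
    by (auto simp: image_def)
  have "{C \<in> gr W \<rho> l. gr_euler W \<rho> l C = gr_class W \<rho> l (\<lambda>z vs. 0)} = gr_elem W \<rho> l ` ?ker"
  proof (intro equalityI subsetI)
    fix C assume "C \<in> {C \<in> gr W \<rho> l. gr_euler W \<rho> l C = gr_class W \<rho> l (\<lambda>z vs. 0)}"
    then obtain A where A: "A \<in> smooth_coeffs W l" and C: "C = gr_elem W \<rho> l A"
      and zero: "gr_elem W \<rho> l (euler_symbol l A) = gr_class W \<rho> l (\<lambda>z vs. 0)"
      using formula unfolding classes by auto
    \<comment> \<open>The complementary projection, so that \<open>A\<close> is the sum of the two eigenparts of the flip.\<close>
    let ?K = "\<lambda>a b I z. 1 / 2 * (A a b I z + (- 1) ^ l * A b a I z)"
    have K: "?K \<in> smooth_coeffs W l" by (rule smooth_coeffs_flip_lincomb[OF assms(1) A])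
    have "C = gr_elem W \<rho> l (\<lambda>a b I z. ?K a b I z + euler_symbol l A a b I z)"
      unfolding C by (intro gr_elem_cong) (simp add: field_simps)
    also have "\<dots> = gr_elem W \<rho> l ?K"
      by (rule gr_elem_add_zero_class[OF assms(1) K smooth_coeffs_flip_lincomb[OF assms(1) A] zero])
    finally have "C = gr_elem W \<rho> l ?K" .
    moreover have "?K a b I z = (- 1) ^ l * ?K b a I z" for a b I z
      by (simp add: algebra_simps sq)
    ultimately show "C \<in> gr_elem W \<rho> l ` ?ker" using K by blast
  next
    fix C assume "C \<in> gr_elem W \<rho> l ` ?ker"
    then obtain A where A: "A \<in> ?ker" and C: "C = gr_elem W \<rho> l A" by blast
    have flip: "(- 1) ^ l * A b a I z = A a b I z" if "size I = l" for a b I z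
      by (rule sym) (use A that in blast)
    have "gr_elem W \<rho> l (euler_symbol l A) = gr_elem W \<rho> l (\<lambda>a b I z. 0)"
      by (intro gr_elem_cong) (simp add: flip)
    then show "C \<in> {C \<in> gr W \<rho> l. gr_euler W \<rho> l C = gr_class W \<rho> l (\<lambda>z vs. 0)}"
      using formula[of A l] gr_elem_in_gr[of A W l \<rho>] A gr_elem_zero[of W \<rho> l] C by auto
  qed
  then show "{C \<in> gr W \<rho> l. gr_euler W \<rho> l C = gr_class W \<rho> l (\<lambda>z vs. 0)} =
       {gr_elem W \<rho> l A | A. A \<in> smooth_coeffs W l \<and>
          (\<forall>a b I z. size I = l \<longrightarrow> A a b I z = (- 1) ^ l * A b a I z)}"
    by (auto simp: image_def)
qed

end
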